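(* \[\lim_{d\to\infty}\frac{DC(d,2)}{d^2}=\frac{1}{2},\] where, for a positive integer $d$, $DC(d,2)$ denotes the largest number of vertices in a Cayley graph of a dihedral group having degree $d$ and diameter $2$.
   Context: For a finite group $G$ and a subset $S\subset G$ which is inverse-closed and does not contain the identity, the Cayley graph $\mathrm{Cay}(G,S)$ is the undirected graph with vertex set $G$ and an edge between $g$ and $h$ if and only if $gh^{-1}\in S$. It is regular of degree $|S|$. The dihedral groups are the groups $\mathbb{Z}_m\rtimes C_2$ of order $2m$, where $C_2=\{\pm1\}$ acts on the cyclic group $\mathbb{Z}_m$ by inversion. $DC(d,k)$ is the largest number of vertices in a Cayley graph of a dihedral group having degree $d$ and diameter $k$. *)

theory Defs
  imports Complex_Main "HOL-Algebra.Elementary_Groups" "Graph_Theory.Graph_Theory"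
begin

section \<open>Dihedral groups\<close>

definition semidirect_product ::
    "('a, 'c) monoid_scheme \<Rightarrow> ('b, 'd) monoid_scheme \<Rightarrow> ('b \<Rightarrow> 'a \<Rightarrow> 'a) \<Rightarrow> ('a \<times> 'b) monoid"
  where "semidirect_product N H \<phi> =
    \<lparr> carrier = carrier N \<times> carrier H,
      monoid.mult = (\<lambda>(x, s) (y, t). (x \<otimes>\<^bsub>N\<^esub> \<phi> s y, s \<otimes>\<^bsub>H\<^esub> t)),
      one = (\<one>\<^bsub>N\<^esub>, \<one>\<^bsub>H\<^esub>) \<rparr>"

definition sign_group :: "int monoid"
  where "sign_group = \<lparr> carrier = {1, -1}, monoid.mult = (*), one = 1 \<rparr>"

text \<open>
  The dihedral group of order \<open>2 * m\<close>, for \<open>m \<ge> 1\<close>.  (\<open>integer_mod_group 0\<close> is the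
  infinite cyclic group, so \<open>m = 0\<close> has to be excluded wherever this is used.)
\<close>
definition dihedral_group :: "nat \<Rightarrow> (int \<times> int) monoid"
  where "dihedral_group m =
    semidirect_product (integer_mod_group m) sign_group
      (\<lambda>s x. if s = 1 then x else inv\<^bsub>integer_mod_group m\<^esub> x)"

lemma integer_mod_group_inv:
  assumes "m > 0" and "x \<in> carrier (integer_mod_group m)"
  shows "inv\<^bsub>integer_mod_group m\<^esub> x = (- x) mod int m"
proof (rule group.inv_equality[OF group_integer_mod_group])
  show "(- x) mod int m \<otimes>\<^bsub>integer_mod_group m\<^esub> x = \<one>\<^bsub>integer_mod_group m\<^esub>"
    using assms(1) by (simp add: integer_mod_group_def mod_simps)
qed (use assms in \<open>auto simp: carrier_integer_mod_group\<close>)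

lemma carrier_dihedral_group:
  assumes "m > 0"
  shows "carrier (dihedral_group m) = {0..<int m} \<times> {1, -1}"
  using assms
  by (simp add: dihedral_group_def semidirect_product_def sign_group_def carrier_integer_mod_group)

lemma one_dihedral_group: "\<one>\<^bsub>dihedral_group m\<^esub> = (0, 1)"
  by (simp add: dihedral_group_def semidirect_product_def sign_group_def)

lemma mult_dihedral_group:
  assumes "m > 0" "p \<in> carrier (dihedral_group m)" "q \<in> carrier (dihedral_group m)"
  shows "p \<otimes>\<^bsub>dihedral_group m\<^esub> q = ((fst p + snd p * fst q) mod int m, snd p * snd q)"
proof -
  obtain x s y t where [simp]: "p = (x, s)" "q = (y, t)" by (cases p, cases q)
  have y: "y \<in> carrier (integer_mod_group m)" and s: "s = 1 \<or> s = -1"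
    using assms by (auto simp: carrier_dihedral_group carrier_integer_mod_group)
  show ?thesis
    using s assms(1) integer_mod_group_inv[OF assms(1) y]
    by (auto simp: dihedral_group_def semidirect_product_def sign_group_def
          integer_mod_group_def mod_simps)
qed

lemma group_dihedral_group:
  assumes m: "m > 0"
  shows "group (dihedral_group m)"
proof (rule groupI, goal_cases)
  case (1 x y)
  then show ?case using m by (auto simp: mult_dihedral_group carrier_dihedral_group)
next
  case 2
  then show ?case using m by (auto simp: one_dihedral_group carrier_dihedral_group)
next
  case (3 x y z)
  have c: "p \<otimes>\<^bsub>dihedral_group m\<^esub> q \<in> carrier (dihedral_group m)"
    if "p \<in> carrier (dihedral_group m)" "q \<in> carrier (dihedral_group m)" for p q
    using m that by (auto simp: mult_dihedral_group carrier_dihedral_group)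
  have eq: "(b + a mod k) mod k = (a' + u * (b' mod k)) mod k"
    if "a + b = a' + u * b'" for a b a' u b' k :: int
    using that by (metis add.commute mod_add_left_eq mod_add_right_eq mod_mult_right_eq)
  show ?case
    by (subst mult_dihedral_group[OF m c[OF 3(1,2)] 3(3)],
        subst mult_dihedral_group[OF m 3(1) c[OF 3(2,3)]])
      (auto simp: mult_dihedral_group[OF m 3(1,2)] mult_dihedral_group[OF m 3(2,3)]
        algebra_simps intro!: eq)
next
  case (4 x)
  then show ?case using m
    by (auto simp: mult_dihedral_group one_dihedral_group carrier_dihedral_group)
next
  case (5 x)
  then obtain a s where x: "x = (a, s)" "0 \<le> a" "a < int m" "s = 1 \<or> s = -1"
    using m by (auto simp: carrier_dihedral_group)
  define y where "y = ((- s * a) mod int m, s)"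
  have "y \<in> carrier (dihedral_group m)"
    using m x by (auto simp: y_def carrier_dihedral_group)
  moreover from this have "y \<otimes>\<^bsub>dihedral_group m\<^esub> x = \<one>\<^bsub>dihedral_group m\<^esub>"
    using m x 5 by (auto simp: y_def mult_dihedral_group one_dihedral_group mod_simps)
  ultimately show ?case by blast
qed

lemma order_dihedral_group:
  assumes "m > 0"
  shows "order (dihedral_group m) = 2 * m"
  using assms by (simp add: order_def carrier_dihedral_group card_cartesian_product)


section \<open>Cayley graphs\<close>

definition connection_set :: "('a, 'b) monoid_scheme \<Rightarrow> 'a set \<Rightarrow> bool"
  where "connection_set G S \<longleftrightarrow>
    S \<subseteq> carrier G \<and> \<one>\<^bsub>G\<^esub> \<notin> S \<and> (\<forall>s\<in>S. inv\<^bsub>G\<^esub> s \<in> S)"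

text \<open>
  Undirected graphs are represented as symmetric digraphs, an edge being a pair of
  opposite arcs, so that the degree of a vertex is its out-degree.
\<close>
definition Cay :: "('a, 'b) monoid_scheme \<Rightarrow> 'a set \<Rightarrow> 'a pair_pre_digraph"
  where "Cay G S =
    \<lparr> pverts = carrier G,
      parcs = {(g, h). g \<in> carrier G \<and> h \<in> carrier G \<and> g \<otimes>\<^bsub>G\<^esub> inv\<^bsub>G\<^esub> h \<in> S} \<rparr>"

lemma pair_graph_Cay:
  assumes "group G" "finite (carrier G)" "connection_set G S"
  shows "pair_graph (Cay G S)"
proof -
  interpret group G by fact
  have "parcs (Cay G S) \<subseteq> carrier G \<times> carrier G" by (auto simp: Cay_def)
  then have "finite (parcs (Cay G S))"
    using assms(2) by (meson finite_SigmaI finite_subset)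
  moreover have "h \<otimes>\<^bsub>G\<^esub> inv\<^bsub>G\<^esub> g \<in> S"
    if "g \<in> carrier G" "h \<in> carrier G" "g \<otimes>\<^bsub>G\<^esub> inv\<^bsub>G\<^esub> h \<in> S" for g h
    using that assms(3) inv_mult_group[of g "inv\<^bsub>G\<^esub> h"]
    by (force simp: connection_set_def)
  then have "symmetric (with_proj (Cay G S))"
    unfolding symmetric_def sym_def by (auto simp: Cay_def arcs_ends_def arc_to_ends_def)
  ultimately show ?thesis
    using assms(2,3) by unfold_locales (auto simp: Cay_def connection_set_def)
qed

definition regular_of_degree :: "('a, 'b) pre_digraph \<Rightarrow> nat \<Rightarrow> bool"
  where "regular_of_degree G d \<longleftrightarrow> (\<forall>v\<in>verts G. out_degree G v = d)"

lemma regular_of_degree_Cay: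
  assumes "group G" "connection_set G S"
  shows "regular_of_degree (with_proj (Cay G S)) (card S)"
  unfolding regular_of_degree_def
proof
  interpret group G by fact
  fix g assume "g \<in> verts (with_proj (Cay G S))"
  then have g: "g \<in> carrier G" by (simp add: Cay_def)
  have S: "S \<subseteq> carrier G" using assms(2) by (simp add: connection_set_def)
  have "bij_betw (\<lambda>s. (g, inv\<^bsub>G\<^esub> s \<otimes>\<^bsub>G\<^esub> g)) S (out_arcs (with_proj (Cay G S)) g)"
  proof (rule bij_betw_byWitness[where f' = "\<lambda>(g, h). g \<otimes>\<^bsub>G\<^esub> inv\<^bsub>G\<^esub> h"])
    have *: "g \<otimes>\<^bsub>G\<^esub> inv\<^bsub>G\<^esub> (inv\<^bsub>G\<^esub> s \<otimes>\<^bsub>G\<^esub> g) = s" if "s \<in> S" for s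
      using that S g by (auto simp: inv_mult_group subset_iff m_assoc[symmetric])
    then show "\<forall>s\<in>S. (\<lambda>(g, h). g \<otimes>\<^bsub>G\<^esub> inv\<^bsub>G\<^esub> h) (g, inv\<^bsub>G\<^esub> s \<otimes>\<^bsub>G\<^esub> g) = s" by simp
    show "(\<lambda>s. (g, inv\<^bsub>G\<^esub> s \<otimes>\<^bsub>G\<^esub> g)) ` S \<subseteq> out_arcs (with_proj (Cay G S)) g"
      using S g * by (auto simp: Cay_def out_arcs_def subset_iff)
    show "\<forall>a\<in>out_arcs (with_proj (Cay G S)) g.
        (g, inv\<^bsub>G\<^esub> (case a of (g, h) \<Rightarrow> g \<otimes>\<^bsub>G\<^esub> inv\<^bsub>G\<^esub> h) \<otimes>\<^bsub>G\<^esub> g) = a"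
      using g by (auto simp: Cay_def out_arcs_def inv_mult_group m_assoc)
    show "(\<lambda>(g, h). g \<otimes>\<^bsub>G\<^esub> inv\<^bsub>G\<^esub> h) ` out_arcs (with_proj (Cay G S)) g \<subseteq> S"
      by (auto simp: Cay_def out_arcs_def)
  qed
  then show "out_degree (with_proj (Cay G S)) g = card S"
    unfolding out_degree_def by (metis bij_betw_same_card)
qed

text \<open>
  With all arc weights equal to \<open>1\<close>, the library's weighted distance is the number of arcs of
  a shortest walk, and it is \<open>\<infinity>\<close> if there is no walk.
\<close>
definition graph_distance :: "('a, 'b) pre_digraph \<Rightarrow> 'a \<Rightarrow> 'a \<Rightarrow> ereal"
  where "graph_distance G u v = wf_digraph.\<mu> G (\<lambda>_. 1) u v"

lemma graph_distance_conv:
  assumes "wf_digraph G"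
  shows "graph_distance G u v = (INF p\<in>{p. pre_digraph.awalk G u p v}. ereal (real (length p)))"
proof -
  interpret wf_digraph G by fact
  show ?thesis
    by (simp add: graph_distance_def \<mu>_def awalk_cost_def map_replicate_const sum_list_replicate)
qed

definition graph_diameter :: "('a, 'b) pre_digraph \<Rightarrow> ereal"
  where "graph_diameter G = (SUP u\<in>verts G. SUP v\<in>verts G. graph_distance G u v)"

text \<open>
  The maximum is over a finite set (Moore bound).  \<open>DC d k\<close> is unspecified for those \<open>d\<close> and
  \<open>k\<close>, such as \<open>d = 1\<close> and \<open>k = 2\<close>, for which there is no such graph.
\<close>
definition DC :: "nat \<Rightarrow> nat \<Rightarrow> nat"
  where "DC d k = Max {card (verts (with_proj (Cay (dihedral_group m) S))) | m S.
    m \<ge> 1 \<and> connection_set (dihedral_group m) S \<and>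
    regular_of_degree (with_proj (Cay (dihedral_group m) S)) d \<and>
    graph_diameter (with_proj (Cay (dihedral_group m) S)) = ereal (real k)}"

end

theory Submission
  imports Defs "HOL-Algebra.Multiplicative_Group" "HOL-Algebra.Algebraic_Closure_Type"
    "HOL-Number_Theory.Cong" "HOL-Analysis.Kronecker_Approximation_Theorem"
begin

text \<open>
  Write a connection set of the dihedral group of order \<open>2 * m\<close> as
  \<open>R \<times> {1} \<union> B \<times> {-1}\<close> with \<open>R, B \<subseteq> \<int>\<^sub>m\<close> and \<open>R = -R\<close>.  Since \<open>R\<close> is symmetric, a rotation times a
  reflection and a reflection times a rotation give the same set \<open>R + B\<close> of reflections, so
  diameter 2 means that \<open>({0} \<union> R) + B\<close> and \<open>{0} \<union> R \<union> (R + R) \<union> (B - B)\<close> are all of \<open>\<int>\<^sub>m\<close>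
  (lemma \<open>dihedral_witness_iff\<close>).

  The first condition gives the upper bound: \<open>m \<le> (card R + 1) * card B\<close>, and the two factors
  have sum \<open>d + 1\<close>, so \<open>4 * m \<le> (d + 1)\<^sup>2\<close> (\<open>dihedral_witness_order_le\<close>).

  For the lower bound it suffices to find a symmetric \<open>A\<close> and a set \<open>B\<close>, both of size about
  \<open>sqrt m\<close>, with \<open>A + B = \<int>\<^sub>m = B - B\<close> (\<open>cover_pair\<close>, \<open>dihedral_witness_exists\<close>).  For a prime power
  \<open>q\<close> and \<open>m = q\<^sup>2 - 1\<close> take for \<open>B\<close> the logarithms of an affine line of the plane \<open>GF(q\<^sup>2)\<close> over
  \<open>GF(q)\<close> that misses the origin (the Bose relative difference set), and for \<open>A\<close> the subgroup
  of order \<open>q - 1\<close>, that is, the logarithms of the scalars.  Scalar multiples of the line cover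
  everything but one direction, quotients of points of the line give everything but the
  nontrivial scalars, and \<open>O(sqrt q)\<close> additional elements of \<open>B\<close> repair both defects (\<open>cover_pair_bose\<close>).

  This settles the degrees close to \<open>2 * q\<close>.  To reach all degrees without any information on gaps
  between primes, two such pairs are multiplied: the digit expansions
  \<open>x + m\<^sub>1 * y\<close> with \<open>x\<close> and \<open>y\<close> from pairs for \<open>m\<^sub>1\<close> and \<open>m\<^sub>2\<close> form a pair for \<open>m\<^sub>1 * m\<^sub>2\<close>
  (\<open>cover_pair_mult\<close>).  With \<open>q = 2 ^ i\<close> and \<open>q = 3 ^ j\<close> this serves the degrees close to
  \<open>2 * 2 ^ i * 3 ^ j\<close>, and because \<open>ln 2 / ln 3\<close> is irrational the numbers \<open>2 ^ i * 3 ^ j\<close> with large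
  \<open>i\<close> and \<open>j\<close> come within any factor \<open>1 + \<epsilon>\<close> of every large real number
  (\<open>powers_2_3_dense\<close>).  The degree is finally adjusted by adding arbitrary reflections,
  which are involutions.
\<close>

section \<open>Diameter of Cayley graphs\<close>

lemma graph_distance_le_iff:
  assumes "wf_digraph G"
  shows "graph_distance G u v \<le> ereal (real n) \<longleftrightarrow> (\<exists>p. pre_digraph.awalk G u p v \<and> length p \<le> n)"
proof
  assume "\<exists>p. pre_digraph.awalk G u p v \<and> length p \<le> n"
  then show "graph_distance G u v \<le> ereal (real n)"
    unfolding graph_distance_conv[OF assms] by (force intro: INF_lower2)
next
  assume le: "graph_distance G u v \<le> ereal (real n)"
  show "\<exists>p. pre_digraph.awalk G u p v \<and> length p \<le> n"
  proof (rule ccontr)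
    assume "\<not> ?thesis"
    then have "ereal (real (Suc n)) \<le> graph_distance G u v"
      unfolding graph_distance_conv[OF assms] by (force intro!: INF_greatest)
    from order_trans[OF this le] show False by simp
  qed
qed

text \<open>
  Distances are integers or infinite, which excludes values strictly between consecutive
  integers; this is what makes the supremum defining the diameter attained.
\<close>
lemma graph_distance_ge_Suc:
  assumes "wf_digraph G" "\<not> graph_distance G u v \<le> ereal (real n)"
  shows "ereal (real (Suc n)) \<le> graph_distance G u v"
  unfolding graph_distance_conv[OF assms(1)]
  using assms(2)[unfolded graph_distance_le_iff[OF assms(1)]]
  by (force intro!: INF_greatest)

lemma graph_diameter_eq_Suc_iff:
  assumes "wf_digraph G"
  shows "graph_diameter G = ereal (real (Suc n)) \<longleftrightarrow>
    (\<forall>u\<in>verts G. \<forall>v\<in>verts G. graph_distance G u v \<le> ereal (real (Suc n))) \<and>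
    (\<exists>u\<in>verts G. \<exists>v\<in>verts G. \<not> graph_distance G u v \<le> ereal (real n))"
    (is "?L \<longleftrightarrow> ?A \<and> ?B")
proof -
  have le: "graph_diameter G \<le> c \<longleftrightarrow> (\<forall>u\<in>verts G. \<forall>v\<in>verts G. graph_distance G u v \<le> c)" for c
    by (simp add: graph_diameter_def SUP_le_iff)
  have "ereal (real (Suc n)) \<le> graph_diameter G" if ?B
  proof -
    from that obtain u v where uv: "u \<in> verts G" "v \<in> verts G"
      "\<not> graph_distance G u v \<le> ereal (real n)" by blast
    have "ereal (real (Suc n)) \<le> graph_distance G u v"
      using graph_distance_ge_Suc[OF assms uv(3)] .
    also have "\<dots> \<le> graph_diameter G"
      using le[of "graph_diameter G"] uv by blast
    finally show ?thesis .
  qed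
  moreover have ?B if ?L
  proof (rule ccontr)
    assume "\<not> ?B"
    then have "graph_diameter G \<le> ereal (real n)" by (auto simp: le)
    with that show False by simp
  qed
  ultimately show ?thesis
    using le[of "ereal (real (Suc n))"] by (metis order_antisym order_refl)
qed

lemma graph_distance_le_Suc_iff:
  assumes "wf_digraph G" "u \<in> verts G"
  shows "graph_distance G u v \<le> ereal (real (Suc n)) \<longleftrightarrow>
    u = v \<or> (\<exists>e\<in>arcs G. tail G e = u \<and> graph_distance G (head G e) v \<le> ereal (real n))"
proof -
  interpret wf_digraph G by fact
  have "(\<exists>p. awalk u p v \<and> length p \<le> Suc n) \<longleftrightarrow>
      u = v \<or> (\<exists>e\<in>arcs G. tail G e = u \<and> (\<exists>p. awalk (head G e) p v \<and> length p \<le> n))"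
    (is "?L \<longleftrightarrow> ?R")
  proof
    assume ?L
    then obtain p where "awalk u p v" "length p \<le> Suc n" by blast
    then show ?R by (cases p) (auto simp: awalk_Nil_iff awalk_Cons_iff)
  next
    assume ?R
    then consider "u = v"
      | e p where "e \<in> arcs G" "tail G e = u" "awalk (head G e) p v" "length p \<le> n" by blast
    then show ?L
    proof cases
      case 1
      then show ?thesis using assms(2) by (intro exI[of _ "[]"]) (simp add: awalk_Nil_iff)
    next
      case 2
      then show ?thesis by (intro exI[of _ "e # p"]) (simp add: awalk_Cons_iff)
    qed
  qed
  then show ?thesis by (simp only: graph_distance_le_iff[OF assms(1)])
qed

lemma graph_distance_le_0_iff:
  assumes "wf_digraph G" "u \<in> verts G"
  shows "graph_distance G u v \<le> ereal (real 0) \<longleftrightarrow> u = v"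
proof -
  interpret wf_digraph G by fact
  show ?thesis
    unfolding graph_distance_le_iff[OF assms(1)] using assms(2) by (auto simp: awalk_Nil_iff)
qed

text \<open>
  A walk from \<open>u\<close> to \<open>v\<close> of length \<open>n\<close> factors \<open>u \<otimes> inv v\<close> into \<open>n\<close> elements of \<open>S\<close>, and every
  group element is such a quotient, so distances turn into a statement about products.
\<close>
lemma graph_diameter_Cay_eq_2_iff:
  assumes "group G" "finite (carrier G)" "connection_set G S"
  shows "graph_diameter (with_proj (Cay G S)) = ereal (real 2) \<longleftrightarrow>
    (\<forall>x\<in>carrier G. x = \<one>\<^bsub>G\<^esub> \<or> x \<in> S \<or> (\<exists>s\<in>S. \<exists>t\<in>S. x = s \<otimes>\<^bsub>G\<^esub> t)) \<and>
    (\<exists>x\<in>carrier G. x \<noteq> \<one>\<^bsub>G\<^esub> \<and> x \<notin> S)"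
proof -
  interpret group G by fact
  let ?C = "with_proj (Cay G S)"
  interpret C: pair_graph "Cay G S" using assms by (rule pair_graph_Cay)
  have wf: "wf_digraph ?C" by (rule C.wf_digraph)
  have S: "S \<subseteq> carrier G" using assms(3) by (simp add: connection_set_def)
  have verts: "verts ?C = carrier G" by (simp add: Cay_def)
  have eq: "u = v \<longleftrightarrow> u \<otimes>\<^bsub>G\<^esub> inv\<^bsub>G\<^esub> v = \<one>\<^bsub>G\<^esub>"
    if "u \<in> carrier G" "v \<in> carrier G" for u v
    using that by (metis inv_closed inv_inv inv_equality r_inv)
  have step: "graph_distance ?C u v \<le> ereal (real (Suc n)) \<longleftrightarrow> u = v \<or>
      (\<exists>w\<in>carrier G. u \<otimes>\<^bsub>G\<^esub> inv\<^bsub>G\<^esub> w \<in> S \<and> graph_distance ?C w v \<le> ereal (real n))"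
    if "u \<in> carrier G" for u v n
  proof -
    have u: "u \<in> verts ?C" using that unfolding verts .
    have "(\<exists>e\<in>arcs ?C. tail ?C e = u \<and> P (head ?C e)) \<longleftrightarrow>
        (\<exists>w\<in>carrier G. u \<otimes>\<^bsub>G\<^esub> inv\<^bsub>G\<^esub> w \<in> S \<and> P w)" for P
      using that by (force simp: Cay_def)
    from this[of "\<lambda>w. graph_distance ?C w v \<le> ereal (real n)"] show ?thesis
      by (simp only: graph_distance_le_Suc_iff[OF wf u])
  qed
  have d1: "graph_distance ?C u v \<le> ereal (real 1) \<longleftrightarrow>
      u \<otimes>\<^bsub>G\<^esub> inv\<^bsub>G\<^esub> v = \<one>\<^bsub>G\<^esub> \<or> u \<otimes>\<^bsub>G\<^esub> inv\<^bsub>G\<^esub> v \<in> S"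
    if u: "u \<in> carrier G" and v: "v \<in> carrier G" for u v
  proof -
    have "graph_distance ?C w v \<le> ereal (real 0) \<longleftrightarrow> w = v" if "w \<in> carrier G" for w
      using that by (intro graph_distance_le_0_iff[OF wf]) (simp only: verts)
    then show ?thesis using step[OF u, of v 0] u v eq[OF u v] by auto
  qed
  have d2: "graph_distance ?C u v \<le> ereal (real 2) \<longleftrightarrow>
      u \<otimes>\<^bsub>G\<^esub> inv\<^bsub>G\<^esub> v = \<one>\<^bsub>G\<^esub> \<or> u \<otimes>\<^bsub>G\<^esub> inv\<^bsub>G\<^esub> v \<in> S \<or>
      (\<exists>s\<in>S. \<exists>t\<in>S. u \<otimes>\<^bsub>G\<^esub> inv\<^bsub>G\<^esub> v = s \<otimes>\<^bsub>G\<^esub> t)" (is "?L \<longleftrightarrow> ?R")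
    if u: "u \<in> carrier G" and v: "v \<in> carrier G" for u v
  proof -
    have "?L \<longleftrightarrow> u = v \<or> (\<exists>w\<in>carrier G. u \<otimes>\<^bsub>G\<^esub> inv\<^bsub>G\<^esub> w \<in> S \<and>
        graph_distance ?C w v \<le> ereal (real 1))"
      using step[OF u, of v 1] unfolding Suc_1 .
    also have "(\<exists>w\<in>carrier G. u \<otimes>\<^bsub>G\<^esub> inv\<^bsub>G\<^esub> w \<in> S \<and> graph_distance ?C w v \<le> ereal (real 1)) \<longleftrightarrow>
        (\<exists>w\<in>carrier G. u \<otimes>\<^bsub>G\<^esub> inv\<^bsub>G\<^esub> w \<in> S \<and>
          (w \<otimes>\<^bsub>G\<^esub> inv\<^bsub>G\<^esub> v = \<one>\<^bsub>G\<^esub> \<or> w \<otimes>\<^bsub>G\<^esub> inv\<^bsub>G\<^esub> v \<in> S))"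
      by (rule bex_cong[OF refl]) (simp only: d1[OF _ v])
    also have "u = v \<or> (\<exists>w\<in>carrier G. u \<otimes>\<^bsub>G\<^esub> inv\<^bsub>G\<^esub> w \<in> S \<and>
        (w \<otimes>\<^bsub>G\<^esub> inv\<^bsub>G\<^esub> v = \<one>\<^bsub>G\<^esub> \<or> w \<otimes>\<^bsub>G\<^esub> inv\<^bsub>G\<^esub> v \<in> S)) \<longleftrightarrow> ?R"
    proof
      assume "u = v \<or> (\<exists>w\<in>carrier G. u \<otimes>\<^bsub>G\<^esub> inv\<^bsub>G\<^esub> w \<in> S \<and>
        (w \<otimes>\<^bsub>G\<^esub> inv\<^bsub>G\<^esub> v = \<one>\<^bsub>G\<^esub> \<or> w \<otimes>\<^bsub>G\<^esub> inv\<^bsub>G\<^esub> v \<in> S))"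
      then consider "u = v"
        | w where "w \<in> carrier G" "u \<otimes>\<^bsub>G\<^esub> inv\<^bsub>G\<^esub> w \<in> S" "w = v"
        | w where "w \<in> carrier G" "u \<otimes>\<^bsub>G\<^esub> inv\<^bsub>G\<^esub> w \<in> S" "w \<otimes>\<^bsub>G\<^esub> inv\<^bsub>G\<^esub> v \<in> S"
        using eq v by blast
      then show ?R
      proof cases
        case 3
        have "u \<otimes>\<^bsub>G\<^esub> inv\<^bsub>G\<^esub> v = (u \<otimes>\<^bsub>G\<^esub> inv\<^bsub>G\<^esub> w) \<otimes>\<^bsub>G\<^esub> (w \<otimes>\<^bsub>G\<^esub> inv\<^bsub>G\<^esub> v)"
          using u v 3(1) by (simp add: m_assoc inv_solve_left)
        then show ?thesis using 3 by blast
      qed (use u v in auto)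
    next
      assume ?R
      then consider "u = v" | "u \<otimes>\<^bsub>G\<^esub> inv\<^bsub>G\<^esub> v \<in> S"
        | s t where "s \<in> S" "t \<in> S" "u \<otimes>\<^bsub>G\<^esub> inv\<^bsub>G\<^esub> v = s \<otimes>\<^bsub>G\<^esub> t"
        using eq u v by blast
      then show "u = v \<or> (\<exists>w\<in>carrier G. u \<otimes>\<^bsub>G\<^esub> inv\<^bsub>G\<^esub> w \<in> S \<and>
        (w \<otimes>\<^bsub>G\<^esub> inv\<^bsub>G\<^esub> v = \<one>\<^bsub>G\<^esub> \<or> w \<otimes>\<^bsub>G\<^esub> inv\<^bsub>G\<^esub> v \<in> S))"
      proof cases
        case 2
        then show ?thesis using v by auto
      next
        case 3
        have st: "s \<in> carrier G" "t \<in> carrier G" using S 3 by auto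
        have u_eq: "u = s \<otimes>\<^bsub>G\<^esub> (t \<otimes>\<^bsub>G\<^esub> v)"
          using 3(3) u v st by (metis inv_closed inv_solve_right m_assoc m_closed)
        have "u \<otimes>\<^bsub>G\<^esub> inv\<^bsub>G\<^esub> (t \<otimes>\<^bsub>G\<^esub> v) = s" "(t \<otimes>\<^bsub>G\<^esub> v) \<otimes>\<^bsub>G\<^esub> inv\<^bsub>G\<^esub> v = t"
          using u_eq st v by (simp_all add: m_assoc)
        then show ?thesis using 3 st v by (intro disjI2 bexI[of _ "t \<otimes>\<^bsub>G\<^esub> v"]) auto
      qed simp
    qed
    finally show ?thesis .
  qed
  have quot: "(\<exists>u\<in>carrier G. \<exists>v\<in>carrier G. P (u \<otimes>\<^bsub>G\<^esub> inv\<^bsub>G\<^esub> v)) \<longleftrightarrow> (\<exists>x\<in>carrier G. P x)" for P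
  proof
    assume "\<exists>x\<in>carrier G. P x"
    then obtain x where "x \<in> carrier G" "P x" by blast
    then show "\<exists>u\<in>carrier G. \<exists>v\<in>carrier G. P (u \<otimes>\<^bsub>G\<^esub> inv\<^bsub>G\<^esub> v)"
      by (intro bexI[of _ x] bexI[of _ "\<one>\<^bsub>G\<^esub>"]) auto
  qed blast
  have diam: "graph_diameter ?C = ereal (real 2) \<longleftrightarrow>
      (\<forall>u\<in>carrier G. \<forall>v\<in>carrier G. graph_distance ?C u v \<le> ereal (real 2)) \<and>
      (\<exists>u\<in>carrier G. \<exists>v\<in>carrier G. \<not> graph_distance ?C u v \<le> ereal (real 1))"
    using graph_diameter_eq_Suc_iff[OF wf, of 1] by (simp only: verts Suc_1)
  have quot_all: "(\<forall>u\<in>carrier G. \<forall>v\<in>carrier G. P (u \<otimes>\<^bsub>G\<^esub> inv\<^bsub>G\<^esub> v)) \<longleftrightarrow> (\<forall>x\<in>carrier G. P x)" for P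
    using quot[of "\<lambda>x. \<not> P x"] by blast
  let ?Q = "\<lambda>x. x = \<one>\<^bsub>G\<^esub> \<or> x \<in> S \<or> (\<exists>s\<in>S. \<exists>t\<in>S. x = s \<otimes>\<^bsub>G\<^esub> t)"
  have "(\<forall>u\<in>carrier G. \<forall>v\<in>carrier G. graph_distance ?C u v \<le> ereal (real 2)) \<longleftrightarrow>
      (\<forall>u\<in>carrier G. \<forall>v\<in>carrier G. ?Q (u \<otimes>\<^bsub>G\<^esub> inv\<^bsub>G\<^esub> v))"
    by (intro ball_cong refl d2)
  also have "\<dots> \<longleftrightarrow> (\<forall>x\<in>carrier G. ?Q x)" by (rule quot_all[of ?Q])
  finally have all: "(\<forall>u\<in>carrier G. \<forall>v\<in>carrier G. graph_distance ?C u v \<le> ereal (real 2)) \<longleftrightarrow>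
      (\<forall>x\<in>carrier G. ?Q x)" .
  let ?N = "\<lambda>x. x \<noteq> \<one>\<^bsub>G\<^esub> \<and> x \<notin> S"
  have "(\<exists>u\<in>carrier G. \<exists>v\<in>carrier G. \<not> graph_distance ?C u v \<le> ereal (real 1)) \<longleftrightarrow>
      (\<exists>u\<in>carrier G. \<exists>v\<in>carrier G. ?N (u \<otimes>\<^bsub>G\<^esub> inv\<^bsub>G\<^esub> v))"
    by (intro bex_cong refl) (simp only: d1 de_Morgan_disj)
  also have "\<dots> \<longleftrightarrow> (\<exists>x\<in>carrier G. ?N x)" by (rule quot[of ?N])
  finally show ?thesis unfolding diam all by (rule arg_cong)
qed

section \<open>Dihedral Cayley graphs of diameter two\<close>

lemma inv_rotation:
  assumes "m > 0" "x \<in> {0..<int m}"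
  shows "inv\<^bsub>dihedral_group m\<^esub> (x, 1) = ((- x) mod int m, 1)"
proof (rule group.inv_equality[OF group_dihedral_group[OF assms(1)]])
  show "((- x) mod int m, 1) \<otimes>\<^bsub>dihedral_group m\<^esub> (x, 1) = \<one>\<^bsub>dihedral_group m\<^esub>"
    using assms
    by (subst mult_dihedral_group) (auto simp: carrier_dihedral_group one_dihedral_group mod_simps)
qed (use assms in \<open>auto simp: carrier_dihedral_group\<close>)

lemma inv_reflection:
  assumes "m > 0" "x \<in> {0..<int m}"
  shows "inv\<^bsub>dihedral_group m\<^esub> (x, -1) = (x, -1)"
proof (rule group.inv_equality[OF group_dihedral_group[OF assms(1)]])
  show "(x, -1) \<otimes>\<^bsub>dihedral_group m\<^esub> (x, -1) = \<one>\<^bsub>dihedral_group m\<^esub>"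
    using assms by (subst mult_dihedral_group) (auto simp: carrier_dihedral_group one_dihedral_group)
qed (use assms in \<open>auto simp: carrier_dihedral_group\<close>)

definition dihedral_witness :: "nat \<Rightarrow> nat \<Rightarrow> (int \<times> int) set \<Rightarrow> bool"
  where "dihedral_witness d m S \<longleftrightarrow> m \<ge> 1 \<and> connection_set (dihedral_group m) S \<and>
    regular_of_degree (with_proj (Cay (dihedral_group m) S)) d \<and>
    graph_diameter (with_proj (Cay (dihedral_group m) S)) = ereal (real 2)"

lemma card_rotations_reflections:
  fixes R B :: "int set"
  assumes "finite R" "finite B"
  shows "card (R \<times> {1 :: int} \<union> B \<times> {-1}) = card R + card B"
  using assms by (subst card_Un_disjoint) (auto simp: card_cartesian_product)

text \<open>
  Products of two reflections give \<open>B - B\<close>.  Products of a reflection and a rotation in that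
  order give \<open>B - R\<close>, which is \<open>R + B\<close> because \<open>R\<close> is symmetric; so they contribute nothing
  new, and this coincidence is where the factor \<open>1 / 2\<close> of the limit comes from.  The condition
  \<open>d + 1 < 2 * m\<close> says that the graph is not complete, that is, its diameter is not below 2.
\<close>
lemma dihedral_witness_iff:
  fixes R B :: "int set"
  assumes m: "m \<ge> 1" and R: "R \<subseteq> {0..<int m}" and B: "B \<subseteq> {0..<int m}"
  shows "dihedral_witness d m (R \<times> {1} \<union> B \<times> {-1}) \<longleftrightarrow>
    0 \<notin> R \<and> (\<forall>x\<in>R. (- x) mod int m \<in> R) \<and> card R + card B = d \<and> d + 1 < 2 * m \<and>
    (\<forall>t\<in>{0..<int m}. t \<in> insert 0 R \<or> (\<exists>x\<in>R. \<exists>y\<in>R. t = (x + y) mod int m) \<or>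
      (\<exists>x\<in>B. \<exists>y\<in>B. t = (x - y) mod int m)) \<and>
    (\<forall>t\<in>{0..<int m}. t \<in> B \<or> (\<exists>x\<in>R. \<exists>y\<in>B. t = (x + y) mod int m))"
proof -
  let ?G = "dihedral_group m"
  let ?S = "R \<times> {1} \<union> B \<times> {-1 :: int}"
  define rotations where "rotations \<longleftrightarrow> (\<forall>t\<in>{0..<int m}. t \<in> insert 0 R \<or> (\<exists>x\<in>R. \<exists>y\<in>R. t = (x + y) mod int m) \<or>
      (\<exists>x\<in>B. \<exists>y\<in>B. t = (x - y) mod int m))"
  define reflections where "reflections \<longleftrightarrow> (\<forall>t\<in>{0..<int m}. t \<in> B \<or> (\<exists>x\<in>R. \<exists>y\<in>B. t = (x + y) mod int m))"
  have m0: "m > 0" using m by simp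
  have grp: "group ?G" by (rule group_dihedral_group[OF m0])
  have carrier: "carrier ?G = {0..<int m} \<times> {1, -1}" by (rule carrier_dihedral_group[OF m0])
  have fin: "finite (carrier ?G)" by (simp add: carrier)
  have finR: "finite R" "finite B" using R B finite_subset by blast+
  have S: "?S \<subseteq> carrier ?G" using R B by (auto simp: carrier)
  have conn: "connection_set ?G ?S \<longleftrightarrow> 0 \<notin> R \<and> (\<forall>x\<in>R. (- x) mod int m \<in> R)"
  proof -
    have "inv\<^bsub>?G\<^esub> (x, 1) \<in> ?S \<longleftrightarrow> (- x) mod int m \<in> R" if "x \<in> R" for x
      using that R m0 by (subst inv_rotation) auto
    moreover have "inv\<^bsub>?G\<^esub> (x, -1) \<in> ?S" if "x \<in> B" for x
      using that B m0 by (subst inv_reflection) auto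
    ultimately have inv: "(\<forall>s\<in>?S. inv\<^bsub>?G\<^esub> s \<in> ?S) \<longleftrightarrow> (\<forall>x\<in>R. (- x) mod int m \<in> R)"
      by blast
    have "one": "\<one>\<^bsub>?G\<^esub> \<in> ?S \<longleftrightarrow> 0 \<in> R" by (auto simp: one_dihedral_group)
    show ?thesis unfolding connection_set_def inv "one" by (simp only: S simp_thms)
  qed
  have card: "card ?S = card R + card B" by (rule card_rotations_reflections[OF finR])
  have mult: "(x, s) \<otimes>\<^bsub>?G\<^esub> (y, t) = ((x + s * y) mod int m, s * t)"
    if "(x, s) \<in> ?S" "(y, t) \<in> ?S" for x s y t
    using mult_dihedral_group[OF m0, of "(x, s)" "(y, t)"] that S by auto
  {
    assume neg: "\<forall>x\<in>R. (- x) mod int m \<in> R" and "0 \<notin> R"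
    then have C: "connection_set ?G ?S" using conn by blast
    have "one": "\<one>\<^bsub>?G\<^esub> \<notin> ?S" using C by (simp add: connection_set_def)
    have reg: "regular_of_degree (with_proj (Cay ?G ?S)) d \<longleftrightarrow> card R + card B = d"
    proof -
      have "verts (with_proj (Cay ?G ?S)) \<noteq> {}" using m by (simp add: Cay_def carrier)
      then show ?thesis
        using regular_of_degree_Cay[OF grp C] card unfolding regular_of_degree_def by auto
    qed
    have rot: "(t, 1) = \<one>\<^bsub>?G\<^esub> \<or> (t, 1) \<in> ?S \<or> (\<exists>u\<in>?S. \<exists>v\<in>?S. (t, 1) = u \<otimes>\<^bsub>?G\<^esub> v) \<longleftrightarrow>
        t \<in> insert 0 R \<or> (\<exists>x\<in>R. \<exists>y\<in>R. t = (x + y) mod int m) \<or>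
        (\<exists>x\<in>B. \<exists>y\<in>B. t = (x - y) mod int m)" for t
    proof -
      have "(\<exists>u\<in>?S. \<exists>v\<in>?S. (t, 1) = u \<otimes>\<^bsub>?G\<^esub> v) \<longleftrightarrow>
          (\<exists>x\<in>R. \<exists>y\<in>R. t = (x + y) mod int m) \<or> (\<exists>x\<in>B. \<exists>y\<in>B. t = (x - y) mod int m)"
        by (simp add: bex_Un mult)
      then show ?thesis by (auto simp: one_dihedral_group)
    qed
    have refl: "(t, -1) = \<one>\<^bsub>?G\<^esub> \<or> (t, -1) \<in> ?S \<or> (\<exists>u\<in>?S. \<exists>v\<in>?S. (t, -1) = u \<otimes>\<^bsub>?G\<^esub> v) \<longleftrightarrow>
        t \<in> B \<or> (\<exists>x\<in>R. \<exists>y\<in>B. t = (x + y) mod int m)" for t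
    proof -
      have "(\<exists>u\<in>?S. \<exists>v\<in>?S. (t, -1) = u \<otimes>\<^bsub>?G\<^esub> v) \<longleftrightarrow>
          (\<exists>x\<in>R. \<exists>y\<in>B. t = (x + y) mod int m) \<or> (\<exists>x\<in>B. \<exists>y\<in>R. t = (x - y) mod int m)"
        by (simp add: bex_Un mult)
      moreover have "(\<exists>x\<in>B. \<exists>y\<in>R. t = (x - y) mod int m) \<Longrightarrow> (\<exists>x\<in>R. \<exists>y\<in>B. t = (x + y) mod int m)"
      proof clarify
        fix x y assume "x \<in> B" "y \<in> R"
        moreover have "(x - y) mod int m = ((- y) mod int m + x) mod int m"
          by (simp add: mod_simps)
        ultimately show "\<exists>u\<in>R. \<exists>v\<in>B. (x - y) mod int m = (u + v) mod int m"
          using neg by blast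
      qed
      ultimately show ?thesis by (auto simp: one_dihedral_group)
    qed
    have nonadj: "(\<exists>x\<in>carrier ?G. x \<noteq> \<one>\<^bsub>?G\<^esub> \<and> x \<notin> ?S) \<longleftrightarrow> card R + card B + 1 < 2 * m"
    proof -
      have sub: "insert \<one>\<^bsub>?G\<^esub> ?S \<subseteq> carrier ?G"
        using S m0 by (auto simp: carrier one_dihedral_group)
      have c: "card (insert \<one>\<^bsub>?G\<^esub> ?S) = card R + card B + 1"
        using "one" finR by (simp add: card)
      have o: "card (carrier ?G) = 2 * m" using order_dihedral_group[OF m0] by (simp add: Coset.order_def)
      have "(\<exists>x\<in>carrier ?G. x \<noteq> \<one>\<^bsub>?G\<^esub> \<and> x \<notin> ?S) \<longleftrightarrow> insert \<one>\<^bsub>?G\<^esub> ?S \<noteq> carrier ?G"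
        using sub by blast
      also have "\<dots> \<longleftrightarrow> card (insert \<one>\<^bsub>?G\<^esub> ?S) < card (carrier ?G)"
        using sub fin by (metis card_subset_eq less_irrefl order_le_less card_mono)
      finally show ?thesis by (simp only: c o)
    qed
    have "graph_diameter (with_proj (Cay ?G ?S)) = ereal (real 2) \<longleftrightarrow>
        (rotations \<and> reflections) \<and> card R + card B + 1 < 2 * m"
    proof -
      have split: "(\<forall>x\<in>carrier ?G. Q x) \<longleftrightarrow>
          (\<forall>t\<in>{0..<int m}. Q (t, 1)) \<and> (\<forall>t\<in>{0..<int m}. Q (t, -1))" for Q
        by (auto simp: carrier)
      show ?thesis
        by (simp only: graph_diameter_Cay_eq_2_iff[OF grp fin C] nonadj split rot refl
          rotations_def reflections_def)
    qed
    note reg this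
  }
  then show ?thesis
    unfolding dihedral_witness_def conn rotations_def[symmetric] reflections_def[symmetric]
    using m by auto
qed

text \<open>
  Only the reflections are counted: there are \<open>m\<close> of them, and each is a sum of an element of
  \<open>{0} \<union> R\<close> and one of \<open>B\<close>.  The arithmetic-geometric mean inequality does the rest.
\<close>
lemma dihedral_witness_order_le:
  assumes "dihedral_witness d m S"
  shows "4 * m \<le> (d + 1)\<^sup>2"
proof -
  define R where "R = {x. (x, 1) \<in> S}"
  define B where "B = {x. (x, -1) \<in> S}"
  have m: "m \<ge> 1" and "S \<subseteq> carrier (dihedral_group m)"
    using assms by (auto simp: dihedral_witness_def connection_set_def)
  then have "S \<subseteq> {0..<int m} \<times> {1, -1}" by (simp add: carrier_dihedral_group)
  then have S: "S = R \<times> {1} \<union> B \<times> {-1}" and RB: "R \<subseteq> {0..<int m}" "B \<subseteq> {0..<int m}"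
    by (auto simp: R_def B_def)
  then have fin: "finite R" "finite B" using finite_subset by blast+
  have *: "card R + card B = d" "\<forall>t\<in>{0..<int m}. t \<in> B \<or> (\<exists>x\<in>R. \<exists>y\<in>B. t = (x + y) mod int m)"
    using assms unfolding S dihedral_witness_iff[OF m RB] by blast+
  have "{0..<int m} \<subseteq> (\<lambda>(x, y). (x + y) mod int m) ` (insert 0 R \<times> B)"
  proof
    fix t assume t: "t \<in> {0..<int m}"
    then consider "t \<in> B" | x y where "x \<in> R" "y \<in> B" "t = (x + y) mod int m" using *(2) by blast
    then show "t \<in> (\<lambda>(x, y). (x + y) mod int m) ` (insert 0 R \<times> B)"
    proof cases
      case 1
      with t show ?thesis by (intro image_eqI[of _ _ "(0, t)"]) auto
    qed force
  qed
  then have "card {0..<int m} \<le> card (insert 0 R \<times> B)"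
    using fin by (intro surj_card_le) auto
  also have "\<dots> \<le> (card R + 1) * card B"
    by (simp add: card_cartesian_product card_insert_if fin)
  finally have "4 * m \<le> 4 * ((card R + 1) * card B)" by simp
  also have "\<dots> \<le> (card R + 1 + card B)\<^sup>2"
    using sum_squares_ge_zero[of "int (card R + 1) - int (card B)" 0]
    by (simp flip: of_nat_le_iff[where 'a=int] add: power2_eq_square algebra_simps)
  also have "card R + 1 + card B = d + 1" using *(1) by simp
  finally show ?thesis .
qed

text \<open>
  The maximum of the empty set is unspecified, so the upper bound relies on the witness as well.
\<close>
lemma DC_bounds:
  assumes "dihedral_witness d m S"
  shows "2 * m \<le> DC d 2" "2 * DC d 2 \<le> (d + 1)\<^sup>2"
proof -
  have card: "card (verts (with_proj (Cay (dihedral_group n) T))) = 2 * n" if "n \<ge> 1" for n T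
    using that order_dihedral_group[of n] by (simp add: Cay_def Coset.order_def)
  define N where "N = {card (verts (with_proj (Cay (dihedral_group n) T))) | n T. dihedral_witness d n T}"
  have DC: "DC d 2 = Max N"
    unfolding DC_def N_def dihedral_witness_def by (rule refl)
  have bound: "2 * k \<le> (d + 1)\<^sup>2" if "k \<in> N" for k
  proof -
    from that obtain n T where nT: "dihedral_witness d n T"
      "k = card (verts (with_proj (Cay (dihedral_group n) T)))" by (auto simp: N_def)
    then have "k = 2 * n" using card by (simp add: dihedral_witness_def)
    with dihedral_witness_order_le[OF nT(1)] show ?thesis by simp
  qed
  have "finite N"
    by (rule finite_subset[of _ "{..(d + 1)\<^sup>2}"]) (use bound in \<open>force+\<close>)
  have "2 * m \<in> N"
    using assms card[of m S] by (force simp: N_def dihedral_witness_def)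
  then show "2 * m \<le> DC d 2" unfolding DC using \<open>finite N\<close> by simp
  show "2 * DC d 2 \<le> (d + 1)\<^sup>2"
    unfolding DC using Max_in[OF \<open>finite N\<close>] \<open>2 * m \<in> N\<close> bound by blast
qed

section \<open>Covering pairs\<close>

text \<open>
  The sets consist of integers, not of residues: digit expansions with respect to several moduli
  use them unreduced, and symmetry of \<open>A\<close> as a set of integers survives such an expansion.
\<close>
definition cover_pair :: "nat \<Rightarrow> nat \<Rightarrow> nat \<Rightarrow> bool"
  where "cover_pair m a b \<longleftrightarrow> (\<exists>A B :: int set.
    finite A \<and> finite B \<and> card A \<le> a \<and> card B \<le> b \<and> (\<forall>x\<in>A. - x \<in> A) \<and>
    (\<forall>t. \<exists>x\<in>A. \<exists>y\<in>B. [x + y = t] (mod int m)) \<and>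
    (\<forall>t. \<exists>x\<in>B. \<exists>y\<in>B. [x - y = t] (mod int m)))"

text \<open>
  Residues modulo \<open>m1 * m2\<close> are treated as two-digit numbers.  The low digit of a residue is matched
  first; whatever carry this causes is absorbed into the high digit, which can be matched
  because the second pair covers every residue.  This allows moduli with common factors,
  such as \<open>(2 ^ i)\<^sup>2 - 1\<close> and \<open>(3 ^ j)\<^sup>2 - 1\<close>.
\<close>
lemma cover_pair_mult:
  assumes "cover_pair m1 a1 b1" "cover_pair m2 a2 b2"
  shows "cover_pair (m1 * m2) (a1 * a2) (b1 * b2)"
proof -
  obtain A1 B1 where 1: "finite A1" "finite B1" "card A1 \<le> a1" "card B1 \<le> b1"
    "\<And>x. x \<in> A1 \<Longrightarrow> - x \<in> A1"
    "\<And>t. \<exists>x\<in>A1. \<exists>y\<in>B1. [x + y = t] (mod int m1)"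
    "\<And>t. \<exists>x\<in>B1. \<exists>y\<in>B1. [x - y = t] (mod int m1)"
    using assms(1) unfolding cover_pair_def by blast
  obtain A2 B2 where 2: "finite A2" "finite B2" "card A2 \<le> a2" "card B2 \<le> b2"
    "\<And>x. x \<in> A2 \<Longrightarrow> - x \<in> A2"
    "\<And>t. \<exists>x\<in>A2. \<exists>y\<in>B2. [x + y = t] (mod int m2)"
    "\<And>t. \<exists>x\<in>B2. \<exists>y\<in>B2. [x - y = t] (mod int m2)"
    using assms(2) unfolding cover_pair_def by blast
  define f where "f = (\<lambda>(x, y). x + int m1 * y)"
  have card_f: "card (f ` (U \<times> V)) \<le> k * l"
    if "finite U" "finite V" "card U \<le> k" "card V \<le> l" for U V k l
  proof -
    have "card (f ` (U \<times> V)) \<le> card (U \<times> V)"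
      using that by (intro card_image_le) auto
    also have "\<dots> \<le> k * l"
      using that by (simp add: card_cartesian_product mult_le_mono)
    finally show ?thesis .
  qed
  have digits: "[t = c + int m1 * c'] (mod int (m1 * m2))"
    if "t = c + int m1 * t'" "[c' = t'] (mod int m2)" for t c c' t'
    using that by (auto simp: cong_iff_dvd_diff simp flip: right_diff_distrib)
      (metis dvd_minus_iff minus_diff_eq mult_dvd_mono dvd_refl)
  have carry: "\<exists>t'. t = c + int m1 * t'" if "[c = t] (mod int m1)" for c t
    using that by (metis add.commute cong_iff_lin cong_sym mult.commute)
  show ?thesis
    unfolding cover_pair_def
  proof (intro exI conjI ballI allI)
    show "finite (f ` (A1 \<times> A2))" "finite (f ` (B1 \<times> B2))"
      using 1 2 by auto
    show "card (f ` (A1 \<times> A2)) \<le> a1 * a2"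
      by (rule card_f[OF 1(1) 2(1) 1(3) 2(3)])
    show "card (f ` (B1 \<times> B2)) \<le> b1 * b2"
      by (rule card_f[OF 1(2) 2(2) 1(4) 2(4)])
    show "- x \<in> f ` (A1 \<times> A2)" if "x \<in> f ` (A1 \<times> A2)" for x
    proof -
      from that obtain y z where "y \<in> A1" "z \<in> A2" "x = f (y, z)" by blast
      then have "- x = f (- y, - z)" "- y \<in> A1" "- z \<in> A2"
        using 1(5) 2(5) by (auto simp: f_def)
      then show ?thesis by blast
    qed
    fix t :: int
    obtain x1 y1 where xy1: "x1 \<in> A1" "y1 \<in> B1" "[x1 + y1 = t] (mod int m1)" using 1(6) by blast
    obtain t' where t': "t = (x1 + y1) + int m1 * t'" using carry xy1(3) by blast
    obtain x2 y2 where xy2: "x2 \<in> A2" "y2 \<in> B2" "[x2 + y2 = t'] (mod int m2)" using 2(6) by blast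
    have "[f (x1, x2) + f (y1, y2) = t] (mod int (m1 * m2))"
      using digits[OF t' xy2(3)] by (simp add: f_def algebra_simps cong_sym)
    then show "\<exists>x\<in>f ` (A1 \<times> A2). \<exists>y\<in>f ` (B1 \<times> B2). [x + y = t] (mod int (m1 * m2))"
      using xy1 xy2 by blast
  next
    fix t :: int
    obtain x1 y1 where xy1: "x1 \<in> B1" "y1 \<in> B1" "[x1 - y1 = t] (mod int m1)" using 1(7) by blast
    obtain t' where t': "t = (x1 - y1) + int m1 * t'" using carry xy1(3) by blast
    obtain x2 y2 where xy2: "x2 \<in> B2" "y2 \<in> B2" "[x2 - y2 = t'] (mod int m2)" using 2(7) by blast
    have "[f (x1, x2) - f (y1, y2) = t] (mod int (m1 * m2))"
      using digits[OF t' xy2(3)] by (simp add: f_def algebra_simps cong_sym)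
    then show "\<exists>x\<in>f ` (B1 \<times> B2). \<exists>y\<in>f ` (B1 \<times> B2). [x - y = t] (mod int (m1 * m2))"
      using xy1 xy2 by blast
  qed
qed

text \<open>
  The pair has to be thinned out and filled up to a connection set of size exactly \<open>d\<close>: the
  residue \<open>0\<close> is dropped from \<open>A\<close>, since it would be the identity, and arbitrary reflections are
  added, which are their own inverses.  Neither destroys the covering.
\<close>
lemma dihedral_witness_exists:
  assumes "cover_pair m a b" "a + b \<le> d" "d \<le> m" "m \<ge> 2"
  shows "\<exists>S. dihedral_witness d m S"
proof -
  obtain A B where AB: "finite A" "finite B" "card A \<le> a" "card B \<le> b"
    "\<And>x. x \<in> A \<Longrightarrow> - x \<in> A"
    "\<And>t. \<exists>x\<in>A. \<exists>y\<in>B. [x + y = t] (mod int m)"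
    "\<And>t. \<exists>x\<in>B. \<exists>y\<in>B. [x - y = t] (mod int m)"
    using assms(1) unfolding cover_pair_def by blast
  let ?r = "\<lambda>x. x mod int m"
  have m: "m \<ge> 1" "int m > 0" using assms by auto
  define R where "R = ?r ` A - {0}"
  have "card R \<le> a"
    using card_image_le[OF AB(1), of ?r] AB(1,3) card_mono[of "?r ` A" R] by (auto simp: R_def)
  moreover have "card (?r ` B) \<le> b"
    using card_image_le[OF AB(2), of ?r] AB(4) by simp
  ultimately have "card (?r ` B) \<le> d - card R" "d - card R \<le> card {0..<int m}" "card R \<le> d"
    using assms by auto
  moreover have "?r ` B \<subseteq> {0..<int m}" using m by auto
  ultimately obtain C where C: "?r ` B \<subseteq> C" "C \<subseteq> {0..<int m}" "card C = d - card R"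
    using exists_subset_between[of "?r ` B" "d - card R" "{0..<int m}"] by auto
  have R: "R \<subseteq> {0..<int m}" using m by (auto simp: R_def)
  have "dihedral_witness d m (R \<times> {1} \<union> C \<times> {-1})"
    unfolding dihedral_witness_iff[OF m(1) R C(2)]
  proof (intro conjI ballI)
    show "0 \<notin> R" by (simp add: R_def)
    show "card R + card C = d" using C(3) \<open>card R \<le> d\<close> by simp
    show "d + 1 < 2 * m" using assms by simp
  next
    fix x assume "x \<in> R"
    then obtain y where y: "y \<in> A" "x = y mod int m" "y mod int m \<noteq> 0" by (auto simp: R_def)
    then have "(- x) mod int m = (- y) mod int m" by (simp add: mod_simps)
    moreover have "(- y) mod int m \<noteq> 0"
      using y(3) by (simp add: mod_eq_0_iff_dvd)
    ultimately show "(- x) mod int m \<in> R" using AB(5) y(1) by (auto simp: R_def)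
  next
    fix t assume t: "t \<in> {0..<int m}"
    obtain x y where "x \<in> B" "y \<in> B" "[x - y = t] (mod int m)" using AB(7) by blast
    then have "?r x \<in> C" "?r y \<in> C" "t = (?r x - ?r y) mod int m"
      using C(1) t by (auto simp: Cong.cong_def mod_simps)
    then show "t \<in> insert 0 R \<or> (\<exists>x\<in>R. \<exists>y\<in>R. t = (x + y) mod int m) \<or>
        (\<exists>x\<in>C. \<exists>y\<in>C. t = (x - y) mod int m)" by blast
  next
    fix t assume t: "t \<in> {0..<int m}"
    obtain x y where xy: "x \<in> A" "y \<in> B" "[x + y = t] (mod int m)" using AB(6) by blast
    then have *: "?r y \<in> C" "t = (?r x + ?r y) mod int m"
      using C(1) t by (auto simp: Cong.cong_def mod_simps)
    show "t \<in> C \<or> (\<exists>x\<in>R. \<exists>y\<in>C. t = (x + y) mod int m)"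
    proof (cases "?r x = 0")
      case True
      then show ?thesis using * by simp
    next
      case False
      then have "?r x \<in> R" using xy(1) by (simp add: R_def)
      then show ?thesis using * by blast
    qed
  qed
  then show ?thesis by blast
qed

section \<open>Finite fields inside an algebraically closed field\<close>

text \<open>
  The polynomial \<open>X ^ q - X\<close> splits and has derivative \<open>-1\<close>, so its \<open>q\<close> roots are distinct.  They
  form the field with \<open>q\<close> elements.
\<close>
lemma card_frobenius_fixed_points:
  fixes q n :: nat
  assumes p: "prime CHAR('a :: alg_closed_field)" and q: "q = CHAR('a) ^ n" and "n > 0"
  shows "card {x :: 'a. x ^ q = x} = q"
proof -
  define P where "P = Polynomial.monom 1 q - Polynomial.monom (1 :: 'a) 1"
  have q2: "q \<ge> 2"
    using prime_ge_2_nat[OF p] self_le_power[of "CHAR('a)" n] \<open>n > 0\<close> unfolding q by linarith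
  have "(of_nat q :: 'a) = 0"
    using q \<open>n > 0\<close> by (simp add: of_nat_eq_0_iff_char_dvd)
  then have deriv: "poly (pderiv P) x \<noteq> 0" for x
    by (simp add: P_def pderiv_diff pderiv_monom poly_monom)
  have deg: "Polynomial.degree P = q" and "P \<noteq> 0"
  proof -
    have "Polynomial.degree (Polynomial.monom 1 q + (- Polynomial.monom 1 1) :: 'a poly) = q"
      using q2 by (subst degree_add_eq_left) (auto simp: degree_monom_eq)
    then show "Polynomial.degree P = q" by (simp add: P_def)
    then show "P \<noteq> 0" using q2 by force
  qed
  obtain A where A: "size A = q"
    "P = Polynomial.smult (Polynomial.lead_coeff P) (\<Prod>x\<in>#A. [:- x, 1:])"
    using alg_closed_imp_factorization[OF \<open>P \<noteq> 0\<close>] unfolding deg by blast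
  have lc: "Polynomial.lead_coeff P \<noteq> 0" using \<open>P \<noteq> 0\<close> by (rule leading_coeff_neq_0)
  have roots: "{x :: 'a. x ^ q = x} = set_mset A"
  proof -
    have "x ^ q = x \<longleftrightarrow> x \<in># A" for x
    proof -
      have "x ^ q = x \<longleftrightarrow> poly P x = 0" by (simp add: P_def poly_monom)
      also have "\<dots> \<longleftrightarrow> (\<Prod>y\<in>#A. x - y) = 0"
        using lc by (subst A(2)) (simp add: poly_prod_mset image_mset.compositionality o_def)
      also have "\<dots> \<longleftrightarrow> x \<in># A" by (auto simp: prod_mset_zero_iff)
      finally show ?thesis .
    qed
    then show ?thesis by blast
  qed
  have "count A x \<le> 1" for x
  proof (rule ccontr)
    assume "\<not> count A x \<le> 1"
    then have "{#x, x#} \<subseteq># A" by (simp add: subseteq_mset_def)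
    then obtain C where "A = {#x, x#} + C" by (metis subset_mset.add_diff_inverse)
    then have "P = [:- x, 1:] * ([:- x, 1:] * Polynomial.smult (Polynomial.lead_coeff P) (\<Prod>x\<in>#C. [:- x, 1:]))"
      using A(2) by simp
    then obtain R where R: "P = [:- x, 1:] * ([:- x, 1:] * R)" by blast
    have "poly (pderiv P) x = 0"
      by (simp only: R pderiv_mult poly_add poly_mult) simp
    with deriv show False by blast
  qed
  then have "A = mset_set (set_mset A)"
    by (intro multiset_eqI) (metis count_eq_zero_iff count_mset_set(1,3) finite_set_mset le_antisym
      less_one not_le)
  then have "card (set_mset A) = size A" by (metis size_mset_set)
  then show ?thesis using A(1) roots by simp
qed

text \<open>
  Transfers the cyclicity of the multiplicative group of a finite field from a ring with a
  carrier to a finite subset of a type.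
\<close>
lemma finite_subfield_cyclic:
  fixes F :: "'a :: field set"
  assumes "finite F" "0 \<in> F" "1 \<in> F"
    and add: "\<And>x y. x \<in> F \<Longrightarrow> y \<in> F \<Longrightarrow> x + y \<in> F"
    and minus: "\<And>x. x \<in> F \<Longrightarrow> - x \<in> F"
    and mult: "\<And>x y. x \<in> F \<Longrightarrow> y \<in> F \<Longrightarrow> x * y \<in> F"
    and inverse: "\<And>x. x \<in> F \<Longrightarrow> inverse x \<in> F"
  shows "\<exists>g\<in>F. F - {0} = range (\<lambda>i::nat. g ^ i)"
proof -
  define R where "R = \<lparr>carrier = F, monoid.mult = (*) :: 'a \<Rightarrow> _, one = 1, ring.zero = 0, add = (+) :: 'a \<Rightarrow> _\<rparr>"
  have "cring R"
  proof (rule cringI)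
    show "abelian_group R"
      by (rule abelian_groupI) (use assms in \<open>auto simp: R_def algebra_simps intro: exI[of _ "- _"] bexI[of _ "- _"]\<close>)
    show "Group.comm_monoid R"
      by (rule comm_monoidI) (use assms in \<open>auto simp: R_def algebra_simps\<close>)
  qed (auto simp: R_def algebra_simps)
  then interpret R: cring R .
  have "Units R = F - {0}"
  proof -
    have "\<exists>y\<in>F. y * x = 1" if "x \<in> F" "x \<noteq> 0" for x
      using that inverse by (intro bexI[of _ "inverse x"]) auto
    then show ?thesis unfolding Units_def by (auto simp: R_def mult.commute)
  qed
  then have "field R"
    by (intro R.cring_fieldI) (auto simp: R_def)
  then interpret R: field R .
  have pow: "x [^]\<^bsub>R\<^esub> (i::nat) = x ^ i" for x i
    by (induction i) (auto simp: R_def mult.commute nat_pow_def)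
  have "finite (carrier R)" and carrier: "carrier R - {\<zero>\<^bsub>R\<^esub>} = F - {0}"
    using assms(1) by (simp_all add: R_def)
  then obtain g where "g \<in> F - {0}" "F - {0} = {g [^]\<^bsub>R\<^esub> i | i::nat. i \<in> UNIV}"
    using R.finite_field_mult_group_has_gen
    unfolding Multiplicative_Group.carrier_mult_of carrier by blast
  then show ?thesis unfolding pow by (auto simp: full_SetCompr_eq)
qed

section \<open>Covering pairs from affine lines\<close>

text \<open>
  Let \<open>F \<subset> K\<close> be the fields with \<open>q\<close> and \<open>q\<^sup>2\<close> elements, \<open>g\<close> a generator of the group of units
  of \<open>K\<close>, and identify \<open>\<int>\<^sub>m\<close> with that group by \<open>e t = g powi t\<close>.  The units of \<open>F\<close> correspond to
  the multiples of \<open>q + 1\<close>.  The set \<open>B0\<close> corresponds to the line \<open>g + F\<close>, which has \<open>q\<close> points and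
  misses \<open>0\<close> because \<open>g \<notin> F\<close>.

  For \<open>u \<in> K - F\<close> the elements \<open>1, u\<close> form a basis of \<open>K\<close> over \<open>F\<close>.  With \<open>u = g\<close>, every unit is
  a scalar or a scalar multiple of a point of the line; this is \<open>A + B\<close>.  With \<open>u = e t\<close>, the equation
  \<open>g + a = u * (g + b)\<close> is solvable with \<open>a, b \<in> F\<close>, so \<open>u\<close> is a quotient of two points of the line;
  this is \<open>B - B\<close>.  What is left are differences that are multiples of \<open>q + 1\<close>, and they are
  supplied by \<open>E1 - E2\<close>, where the multipliers are written in base \<open>s\<close>.
\<close>
lemma cover_pair_bose:
  fixes q n s :: nat
  assumes p: "prime CHAR('a :: alg_closed_field)" and q: "q = CHAR('a) ^ n" and n: "n > 0"
    and s: "q \<le> s\<^sup>2"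
  shows "cover_pair (q\<^sup>2 - 1) (q + 1) (q + 2 * s)"
proof -
  define F where "F = {x :: 'a. x ^ q = x}"
  define K where "K = {x :: 'a. x ^ (q\<^sup>2) = x}"
  define m where "m = q\<^sup>2 - 1"
  have q2: "q \<ge> 2"
    using prime_ge_2_nat[OF p] self_le_power[of "CHAR('a)" n] n unfolding q by linarith
  have qq: "q\<^sup>2 = CHAR('a) ^ (2 * n)" by (simp add: q power_mult[symmetric] mult.commute)
  have m: "int m = (int q - 1) * (int q + 1)" "q\<^sup>2 = Suc m"
    using q2 by (auto simp: m_def of_nat_diff algebra_simps power2_eq_square)
  have "m > 0" using q2 m(1) by (simp flip: of_nat_0_less_iff[where 'a=int])
  have "s > 0" using s q2 by (cases s) auto
  have cardF: "card F = q" unfolding F_def by (rule card_frobenius_fixed_points[OF p q n])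
  have cardK: "card K = q\<^sup>2"
    unfolding K_def by (rule card_frobenius_fixed_points[OF p qq]) (use n in simp)
  have finF: "finite F" and finK: "finite K"
    using cardF cardK q2 by (auto intro: card_ge_0_finite)

  \<comment> \<open>The Frobenius map is additive, so its fixed points form a subfield.\<close>
  have field: "0 \<in> {x :: 'a. x ^ r = x} \<and> 1 \<in> {x :: 'a. x ^ r = x} \<and>
      (\<forall>x\<in>{x :: 'a. x ^ r = x}. - x \<in> {x. x ^ r = x} \<and> inverse x \<in> {x. x ^ r = x} \<and>
        (\<forall>y\<in>{x. x ^ r = x}. x + y \<in> {x. x ^ r = x} \<and> x * y \<in> {x. x ^ r = x}))"
    if "r = CHAR('a) ^ k" "k > 0" for r k
  proof -
    have r: "r > 0" using that p prime_gt_0_nat by simp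
    have add: "(x + y) ^ r = x ^ r + y ^ r" for x y :: 'a
      by (rule freshmans_dream'[OF p that(1)])
    have neg: "(- x) ^ r = - (x ^ r)" for x :: 'a
      using add[of x "- x"] r by (simp add: eq_neg_iff_add_eq_0 add.commute zero_power)
    show ?thesis using r by (auto simp: add neg power_mult_distrib power_inverse zero_power)
  qed
  note fieldF = field[OF q n, folded F_def]
  have "2 * n > 0" using n by simp
  note fieldK = field[OF qq this, folded K_def]
  have F_diff: "x - y \<in> F" if "x \<in> F" "y \<in> F" for x y
    using that fieldF by (metis diff_conv_add_uminus)
  have K_diff: "x - y \<in> K" if "x \<in> K" "y \<in> K" for x y
    using that fieldK by (metis diff_conv_add_uminus)
  have F_div: "x / y \<in> F" if "x \<in> F" "y \<in> F" for x y
    using that fieldF by (simp add: divide_inverse)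
  have FK: "F \<subseteq> K"
    by (auto simp: F_def K_def power2_eq_square power_mult)

  obtain g where g: "g \<in> K" "K - {0} = range (\<lambda>i::nat. g ^ i)"
    using finite_subfield_cyclic[OF finK] fieldK by blast
  have "g \<noteq> 0" using g(2) by (metis DiffD2 power_one_right rangeI singletonI)
  have gm: "g ^ m = 1"
    using g(1) \<open>g \<noteq> 0\<close> unfolding K_def m(2) by simp
  define e where "e = (\<lambda>t::int. g powi t)"
  have e_add: "e (t + u) = e t * e u" for t u
    using \<open>g \<noteq> 0\<close> by (simp add: e_def power_int_add)
  have e_nz: "e t \<noteq> 0" for t using \<open>g \<noteq> 0\<close> by (simp add: e_def)
  have e_mult: "e (t * int k) = e t ^ k" for t k
    by (simp add: e_def power_int_mult)
  have e_m: "e (int m * t) = 1" for t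
    by (simp add: e_def power_int_mult gm)
  have e_cong1: "e t = e u" if "[t = u] (mod int m)" for t u
    using that by (metis cong_iff_lin e_add e_m mult.right_neutral)
  have e_range: "e ` {0..<int m} = K - {0}"
  proof -
    have "e t \<in> e ` {0..<int m}" for t
      using e_cong1[of t "t mod int m"] \<open>m > 0\<close> by (auto simp: Cong.cong_def intro!: image_eqI[of _ _ "t mod int m"])
    then have "range (\<lambda>i::nat. g ^ i) \<subseteq> e ` {0..<int m}"
      by (metis e_def image_subsetI power_int_of_nat)
    moreover have "e ` {0..<int m} \<subseteq> range (\<lambda>i::nat. g ^ i)"
      by (auto simp: e_def power_int_def)
    ultimately show ?thesis using g(2) by blast
  qed
  have e_inj: "inj_on e {0..<int m}"
  proof (rule eq_card_imp_inj_on)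
    have "card (K - {0}) = m" using cardK m(2) fieldK finK by (simp add: card_Diff_singleton)
    then show "card (e ` {0..<int m}) = card {0..<int m}" by (simp add: e_range)
  qed simp
  have e_eq: "e t = e u \<longleftrightarrow> [t = u] (mod int m)" for t u
  proof
    assume "e t = e u"
    then have "e (t mod int m) = e (u mod int m)"
      using e_cong1[of t "t mod int m"] e_cong1[of u "u mod int m"] by (simp add: Cong.cong_def)
    then show "[t = u] (mod int m)"
      using e_inj \<open>m > 0\<close> by (auto simp: Cong.cong_def inj_on_def)
  qed (rule e_cong1)
  have e_K: "e t \<in> K" for t
    using e_range e_cong1[of t "t mod int m"] \<open>m > 0\<close> by (auto simp: Cong.cong_def)
  have e_surj: "\<exists>k\<in>{0..<int m}. e k = x" if "x \<in> K" "x \<noteq> 0" for x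
    using that e_range by (metis Diff_iff imageE singletonD)
  have e_F: "e t \<in> F \<longleftrightarrow> int q + 1 dvd t" for t
  proof -
    have "e t \<in> F \<longleftrightarrow> e (t * int q) = e t" by (simp add: F_def e_mult)
    also have "\<dots> \<longleftrightarrow> int m dvd t * (int q - 1)"
      by (simp add: e_eq cong_iff_dvd_diff algebra_simps)
    also have "\<dots> \<longleftrightarrow> int q + 1 dvd t"
      using q2 by (simp add: m(1) mult.commute[of t])
    finally show ?thesis .
  qed

  \<comment> \<open>\<open>F \<times> F\<close> and \<open>K\<close> have the same size, so injectivity of \<open>(a, b) \<mapsto> a + u * b\<close> suffices.\<close>
  have basis: "\<exists>a\<in>F. \<exists>b\<in>F. v = a + u * b" if u: "u \<in> K" "u \<notin> F" and v: "v \<in> K" for u v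
  proof -
    define h where "h = (\<lambda>(a, b). a + u * b)"
    have "inj_on h (F \<times> F)"
    proof (rule inj_onI, clarify)
      fix a b c d assume F: "a \<in> F" "b \<in> F" "c \<in> F" "d \<in> F" and "h (a, b) = h (c, d)"
      then have *: "u * (b - d) = c - a" by (simp add: h_def algebra_simps)
      have "b = d"
      proof (rule ccontr)
        assume "b \<noteq> d"
        with * have "u = (c - a) / (b - d)" by (simp add: field_simps)
        with u(2) F F_diff F_div show False by metis
      qed
      with * show "a = c \<and> b = d" by simp
    qed
    then have "card (h ` (F \<times> F)) = card K"
      by (simp add: card_image cardF cardK card_cartesian_product power2_eq_square)
    moreover have "a + u * b \<in> K" if "a \<in> F" "b \<in> F" for a b
      using that u(1) FK fieldK by (meson subsetD)
    then have "h ` (F \<times> F) \<subseteq> K" by (auto simp: h_def)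
    ultimately have "h ` (F \<times> F) = K" by (intro card_subset_eq finK)
    with v show ?thesis by (auto simp: h_def)
  qed

  have g_e: "g = e 1" by (simp add: e_def)
  have "g \<notin> F" using q2 unfolding g_e e_F by (auto dest: zdvd_imp_le)
  have log_line: "\<exists>k. k \<in> {0..<int m} \<and> e k = g + a" if "a \<in> F" for a
  proof -
    have "g + a \<noteq> 0" using that fieldF \<open>g \<notin> F\<close> by (metis eq_neg_iff_add_eq_0)
    moreover have "g + a \<in> K" using that FK fieldK g(1) by blast
    ultimately show ?thesis using e_surj by blast
  qed

  \<comment> \<open>The multipliers are representatives modulo \<open>q - 1\<close> chosen symmetrically around \<open>0\<close>.\<close>
  define A where "A = (\<lambda>k. (int q + 1) * k) ` {- int (q div 2)..int (q div 2)}"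
  define B0 where "B0 = {k \<in> {0..<int m}. e k - g \<in> F}"
  define E1 where "E1 = (\<lambda>i. (int q + 1) * int i) ` {..<s}"
  define E2 where "E2 = (\<lambda>i. - ((int q + 1) * (int s * int i))) ` {..<s}"
  have in_B0: "k \<in> B0" if "k \<in> {0..<int m}" "e k = g + a" "a \<in> F" for k a
    using that by (simp add: B0_def)
  have cardB0: "card B0 \<le> q"
  proof -
    have "card B0 \<le> card F"
    proof (rule card_inj_on_le[OF _ _ finF])
      show "inj_on (\<lambda>k. e k - g) B0" using e_inj by (auto simp: inj_on_def B0_def)
    qed (auto simp: B0_def)
    then show ?thesis by (simp add: cardF)
  qed
  have scale: "[(int q + 1) * a = (int q + 1) * b] (mod int m)"
    if "[a = b] (mod int q - 1)" for a b
    using that unfolding cong_iff_dvd_diff m(1)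
    by (metis dvd_refl mult.commute mult_dvd_mono right_diff_distrib)

  have "cover_pair m (q + 1) (q + 2 * s)"
    unfolding cover_pair_def
  proof (intro exI conjI ballI allI)
    show "finite A" by (simp add: A_def)
    have "finite B0" by (rule finite_subset[of _ "{0..<int m}"]) (auto simp: B0_def)
    then show "finite (B0 \<union> (E1 \<union> E2))" by (simp add: E1_def E2_def)
    show "card A \<le> q + 1"
      unfolding A_def by (rule order_trans[OF card_image_le]) auto
    have "card E1 \<le> s" "card E2 \<le> s"
      unfolding E1_def E2_def by (rule order_trans[OF card_image_le]; simp)+
    then show "card (B0 \<union> (E1 \<union> E2)) \<le> q + 2 * s"
      using cardB0 card_Un_le[of B0 "E1 \<union> E2"] card_Un_le[of E1 E2] by linarith
    show "- x \<in> A" if "x \<in> A" for x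
      using that by (force simp: A_def image_iff intro: bexI[of _ "- _"])
  next
    fix t :: int
    have "\<exists>y\<in>B0 \<union> (E1 \<union> E2). int q + 1 dvd t - y"
    proof -
      obtain a b where ab: "a \<in> F" "b \<in> F" "e t = a + g * b"
        using basis[OF g(1) \<open>g \<notin> F\<close> e_K] by blast
      show ?thesis
      proof (cases "b = 0")
        case True
        with ab have "e t \<in> F" by simp
        then have "int q + 1 dvd t - 0" unfolding e_F by simp
        \<comment> \<open>Points on the line through the origin parallel to \<open>g + F\<close> are scalars, and \<open>0 \<in> B\<close> handles them.\<close>
        moreover have "0 \<in> E1" using \<open>s > 0\<close> by (auto simp: E1_def intro!: image_eqI[of _ _ 0])
        ultimately show ?thesis by blast
      next
        case False
        obtain k where k: "k \<in> {0..<int m}" "e k = g + a / b"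
          using log_line F_div ab by blast
        have "e (t - k) * e k = e t" using e_add[of "t - k" k] by simp
        also have "\<dots> = b * e k" using False by (simp add: ab k distrib_left)
        finally have "e (t - k) = b" using e_nz by simp
        then have "int q + 1 dvd t - k" using ab e_F by metis
        moreover have "k \<in> B0" by (rule in_B0[OF k F_div[OF ab(1,2)]])
        ultimately show ?thesis by blast
      qed
    qed
    then obtain y j where y: "y \<in> B0 \<union> (E1 \<union> E2)" "t - y = (int q + 1) * j" by blast
    define r where "r = j mod (int q - 1)"
    have r: "0 \<le> r" "r < int q - 1" using q2 by (simp_all add: r_def)
    define k where "k = (if r \<le> int (q div 2) then r else r - (int q - 1))"
    have "k \<in> {- int (q div 2)..int (q div 2)}"
      using r by (auto simp: k_def)
    then have "(int q + 1) * k \<in> A" by (simp add: A_def)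
    moreover have "[k = j] (mod int q - 1)"
      by (auto simp: k_def r_def Cong.cong_def)
    then have "[(int q + 1) * k + y = t] (mod int m)"
      using scale y(2) by (metis cong_add_rcancel diff_add_cancel)
    ultimately show "\<exists>x\<in>A. \<exists>y\<in>B0 \<union> (E1 \<union> E2). [x + y = t] (mod int m)"
      using y(1) by blast
  next
    fix t :: int
    show "\<exists>x\<in>B0 \<union> (E1 \<union> E2). \<exists>y\<in>B0 \<union> (E1 \<union> E2). [x - y = t] (mod int m)"
    proof (cases "int q + 1 dvd t")
      case True
      then obtain j where j: "t = (int q + 1) * j" by blast
      define r where "r = nat (j mod (int q - 1))"
      have r: "int r = j mod (int q - 1)" "r < s * s"
      proof -
        show "int r = j mod (int q - 1)" using q2 by (simp add: r_def)
        moreover have "j mod (int q - 1) < int q - 1" using q2 by simp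
        ultimately show "r < s * s" using s by (simp add: power2_eq_square)
      qed
      have "r div s < s" using r(2) by (rule less_mult_imp_div_less)
      then have E: "(int q + 1) * int (r mod s) \<in> E1"
        "- ((int q + 1) * (int s * int (r div s))) \<in> E2"
        using \<open>s > 0\<close> by (auto simp: E1_def E2_def)
      have "int (r mod s) + int s * int (r div s) = int r"
        by (metis mod_mult_div_eq of_nat_add of_nat_mult)
      then have "(int q + 1) * int (r mod s) - (- ((int q + 1) * (int s * int (r div s)))) = (int q + 1) * int r"
        by (metis diff_minus_eq_add distrib_left)
      moreover have "[(int q + 1) * int r = t] (mod int m)"
        unfolding j by (rule scale) (simp add: r(1) Cong.cong_def)
      ultimately show ?thesis using E by (metis UnI1 UnI2)
    next
      case False
      then have u: "e t \<in> K" "e t \<notin> F" by (auto simp: e_K e_F)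
      have "(e t - 1) * g \<in> K" using u g fieldK K_diff by blast
      then obtain a b where ab: "a \<in> F" "b \<in> F" "(e t - 1) * g = a + e t * b"
        using basis[OF u] by blast
      have "- b \<in> F" using ab fieldF by blast
      obtain k where k: "k \<in> {0..<int m}" "e k = g + a" using log_line ab by blast
      obtain l where l: "l \<in> {0..<int m}" "e l = g + - b" using log_line \<open>- b \<in> F\<close> by blast
      have "e (t + l) = e k"
        using ab(3) by (simp add: e_add k l algebra_simps)
      then have "[k - l = t] (mod int m)"
        by (simp add: e_eq cong_iff_dvd_diff) (metis dvd_minus_iff minus_diff_eq diff_diff_eq add.commute)
      then show ?thesis using in_B0 k l ab(1) \<open>- b \<in> F\<close> by blast
    qed
  qed
  then show ?thesis by (simp add: m_def)
qed

text \<open>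
  Concrete fields with 2 and 3 elements, needed as starting points for algebraic closures.
\<close>
lemma CHAR_finite_2: "CHAR(Enum.finite_2) = 2"
proof -
  have "of_nat 2 = (0 :: Enum.finite_2)" by (simp add: numeral_2_eq_2 Enum.one_finite_2_def Enum.plus_finite_2_def Enum.zero_finite_2_def)
  then have "CHAR(Enum.finite_2) dvd 2" by (simp only: of_nat_eq_0_iff_char_dvd)
  then have "CHAR(Enum.finite_2) = 1 \<or> CHAR(Enum.finite_2) = 2"
    using prime_nat_iff two_is_prime_nat by blast
  then show ?thesis using CHAR_not_1 by auto
qed

lemma CHAR_finite_3: "CHAR(Enum.finite_3) = 3"
proof -
  have "of_nat 3 = (0 :: Enum.finite_3)" by (simp add: numeral_3_eq_3 Enum.one_finite_3_def Enum.plus_finite_3_def Enum.zero_finite_3_def)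
  then have "CHAR(Enum.finite_3) dvd 3" by (simp only: of_nat_eq_0_iff_char_dvd)
  then have "CHAR(Enum.finite_3) = 1 \<or> CHAR(Enum.finite_3) = 3"
    using prime_nat_iff[of 3] by auto
  then show ?thesis using CHAR_not_1 by auto
qed

lemma cover_pair_2_power:
  assumes "n > 0" "2 ^ n \<le> s\<^sup>2"
  shows "cover_pair ((2 ^ n)\<^sup>2 - 1) (2 ^ n + 1) (2 ^ n + 2 * s)"
  using assms cover_pair_bose[where 'a = "Enum.finite_2 alg_closure", of "2 ^ n" n s]
  by (simp add: CHAR_finite_2)

lemma cover_pair_3_power:
  assumes "n > 0" "3 ^ n \<le> s\<^sup>2"
  shows "cover_pair ((3 ^ n)\<^sup>2 - 1) (3 ^ n + 1) (3 ^ n + 2 * s)"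
  using assms cover_pair_bose[where 'a = "Enum.finite_3 alg_closure", of "3 ^ n" n s]
  by (simp add: CHAR_finite_3)

section \<open>Products of powers of 2 and 3\<close>

lemma ln_2_div_ln_3_irrational: "ln 2 / ln 3 \<notin> (\<rat> :: real set)"
proof
  assume "ln 2 / ln 3 \<in> (\<rat> :: real set)"
  then obtain a b :: nat where ab: "b \<noteq> 0" "\<bar>ln 2 / ln 3 :: real\<bar> = real a / real b"
    by (rule Rats_abs_nat_div_natE)
  then have "real b * ln 2 = real a * ln (3 :: real)" by (simp add: field_simps)
  then have "ln ((2::real) ^ b) = ln (3 ^ a)" by (simp add: ln_realpow)
  then have "(2::real) ^ b = 3 ^ a" by (subst (asm) ln_inj_iff) auto
  then have "(2::nat) ^ b = 3 ^ a" by (metis of_nat_eq_iff of_nat_numeral of_nat_power)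
  then have "even ((3::nat) ^ a)" using ab(1) by (metis dvd_power gr0I)
  then show False by simp
qed

text \<open>
  Kronecker approximation with the positive target \<open>\<delta>\<close> rather than \<open>0\<close> makes
  \<open>k * ln 2 / ln 3 - h\<close> positive, so that the ratio lies above 1.  This orientation matters: multiplying by
  the ratio only lowers the exponent of 3, of which a supply can be kept.
\<close>
lemma ratio_2_3_powers_close_to_1:
  fixes \<epsilon> :: real
  assumes "\<epsilon> > 0"
  obtains a b :: nat where "1 < 2 ^ a / (3 ^ b :: real)" "2 ^ a / 3 ^ b < 1 + \<epsilon>"
proof -
  define \<theta> where "\<theta> = ln 2 / ln (3 :: real)"
  define \<delta> where "\<delta> = min (1 / 2) (ln (1 + \<epsilon>) / (2 * ln 3))"
  have "\<theta> > 0" by (simp add: \<theta>_def)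
  have "\<delta> > 0" using assms by (simp add: \<delta>_def)
  obtain h k where hk: "k > 0" "\<bar>of_int k * \<theta> - of_int h - \<delta>\<bar> < \<delta>"
    using sequence_of_fractional_parts_is_dense[OF _ \<open>\<delta> > 0\<close>, of \<theta>] ln_2_div_ln_3_irrational
    unfolding \<theta>_def by metis
  have d: "0 < of_int k * \<theta> - of_int h" "of_int k * \<theta> - of_int h < 2 * \<delta>"
    using hk(2) by linarith+
  have "of_int k * \<theta> > 0" using hk(1) \<open>\<theta> > 0\<close> by simp
  moreover have "\<delta> \<le> 1 / 2" by (simp add: \<delta>_def)
  ultimately have "real_of_int h > -1" using d(2) by linarith
  then have "h \<ge> 0" by linarith
  define a b where "a = nat k" and "b = nat h"
  have ab: "of_int k = real a" "of_int h = real b" using hk(1) \<open>h \<ge> 0\<close> by (auto simp: a_def b_def)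
  have exp: "2 ^ a / (3 ^ b :: real) = exp ((real a * \<theta> - real b) * ln 3)"
    by (simp add: \<theta>_def algebra_simps exp_diff exp_of_nat_mult)
  show thesis
  proof
    show "1 < 2 ^ a / (3 ^ b :: real)" using d(1) unfolding exp ab by simp
    have "(real a * \<theta> - real b) * ln 3 < 2 * \<delta> * ln 3" using d(2) unfolding ab by simp
    also have "\<dots> \<le> 2 * (ln (1 + \<epsilon>) / (2 * ln 3)) * ln 3"
      by (intro mult_right_mono mult_left_mono) (auto simp: \<delta>_def)
    also have "\<dots> = ln (1 + \<epsilon>)" by simp
    finally have "exp ((real a * \<theta> - real b) * ln 3) < exp (ln (1 + \<epsilon>))" by simp
    then show "2 ^ a / (3 ^ b :: real) < 1 + \<epsilon>" unfolding exp using assms by simp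
  qed
qed

lemma geometric_bracket:
  fixes u c x :: real
  assumes "u > 1" "c > 0" "c \<le> x"
  obtains k :: nat where "u ^ k * c \<le> x" "x < u ^ Suc k * c"
proof -
  define n where "n = (LEAST n. x < u ^ n * c)"
  obtain n0 where "x / c < u ^ n0" using real_arch_pow[OF assms(1)] by blast
  then have "x < u ^ n0 * c" using assms by (simp add: field_simps)
  then have n: "x < u ^ n * c" unfolding n_def by (rule LeastI)
  then have "n \<noteq> 0" using assms(3) by (cases n) auto
  then obtain k where k: "n = Suc k" by (cases n) auto
  then have "\<not> x < u ^ k * c" using not_less_Least[of k "\<lambda>n. x < u ^ n * c"] by (simp add: n_def)
  with n k show thesis by (intro that[of k]) auto
qed

text \<open>
  Between consecutive values \<open>2 ^ i * C\<close> and \<open>2 ^ (i + 1) * C\<close>, where \<open>C\<close> is a fixed multiple of a high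
  power of 3, one walks upwards with the ratio \<open>u = 2 ^ a / 3 ^ b\<close>, which is only slightly larger than 1.
  As \<open>u ^ N > 2\<close>, fewer than \<open>N\<close> steps are made, and each uses up \<open>b\<close> factors of 3.
\<close>
lemma powers_2_3_dense:
  fixes \<epsilon> :: real and J :: nat
  assumes "\<epsilon> > 0"
  shows "\<exists>x0. \<forall>x\<ge>x0. \<exists>i\<ge>J. \<exists>j\<ge>J. 2 ^ i * 3 ^ j \<le> x \<and> x < (1 + \<epsilon>) * (2 ^ i * 3 ^ j)"
proof -
  obtain a b where ab: "1 < 2 ^ a / (3 ^ b :: real)" "2 ^ a / 3 ^ b < 1 + \<epsilon>"
    using ratio_2_3_powers_close_to_1[OF assms] .
  define u where "u = 2 ^ a / (3 ^ b :: real)"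
  obtain N where N: "2 < u ^ N" using real_arch_pow[of u 2] ab(1) by (auto simp: u_def)
  show ?thesis
  proof (rule exI, intro allI impI)
    fix x :: real assume x: "x \<ge> 2 ^ J * 3 ^ (J + b * N)"
    obtain i where i: "2 ^ i * (2 ^ J * 3 ^ (J + b * N)) \<le> x" "x < 2 ^ Suc i * (2 ^ J * 3 ^ (J + b * N))"
      using geometric_bracket[of 2 "2 ^ J * 3 ^ (J + b * N)" x] x by auto
    define c :: real where "c = 2 ^ i * (2 ^ J * 3 ^ (J + b * N))"
    have c: "c > 0" "c \<le> x" "x < 2 * c" using i by (auto simp: c_def)
    obtain k where k: "u ^ k * c \<le> x" "x < u ^ Suc k * c"
      using geometric_bracket[of u c x] ab(1) c by (auto simp: u_def)
    have "k < N"
    proof (rule ccontr)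
      assume "\<not> k < N"
      then have "u ^ N \<le> u ^ k" using ab(1) by (intro power_increasing) (auto simp: u_def)
      with N have "2 * c < u ^ k * c" using c(1) by simp
      with k(1) c(3) show False by simp
    qed
    then obtain l where l: "N = k + l" by (metis less_imp_add_positive)
    have eq: "u ^ k * c = 2 ^ (i + J + a * k) * 3 ^ (J + b * l)"
      by (simp add: u_def c_def l power_divide power_add power_mult algebra_simps
        flip: power_mult_distrib)
    have "u ^ k * c > 0" using ab(1) c(1) by (simp add: u_def)
    then have "u * (u ^ k * c) < (1 + \<epsilon>) * (u ^ k * c)"
      using ab(2) unfolding u_def by (intro mult_strict_right_mono)
    then have "x < (1 + \<epsilon>) * (u ^ k * c)" using k(2) by (simp add: mult.assoc)
    then show "\<exists>i\<ge>J. \<exists>j\<ge>J. 2 ^ i * 3 ^ j \<le> x \<and> x < (1 + \<epsilon>) * (2 ^ i * 3 ^ j)"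
      using k(1) unfolding eq by (intro exI[of _ "i + J + a * k"] conjI exI[of _ "J + b * l"]) auto
  qed
qed

section \<open>The asymptotic value of DC\<close>

text \<open>
  Choosing \<open>s\<close> about \<open>sqrt q\<close> keeps the repairs in \<open>cover_pair_bose\<close> negligible against \<open>q\<close>.
\<close>
lemma bose_parameters_asymptotic:
  fixes \<delta> :: real
  assumes "\<delta> > 0"
  shows "\<exists>Q. \<forall>q\<ge>Q. \<exists>s. q \<le> s\<^sup>2 \<and> real (q + 1) \<le> (1 + \<delta>) * real q \<and>
    real (q + 2 * s) \<le> (1 + \<delta>) * real q \<and> (1 - \<delta>) * (real q)\<^sup>2 \<le> real (q\<^sup>2 - 1)"
proof (rule exI, intro allI impI)
  fix q :: nat assume Q: "q \<ge> nat \<lceil>max (4 / \<delta>) ((4 / \<delta>)\<^sup>2)\<rceil> + 1"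
  then have q: "real q \<ge> 4 / \<delta>" "real q \<ge> (4 / \<delta>)\<^sup>2" "real q \<ge> 1" by linarith+
  define s where "s = nat \<lceil>sqrt (real q)\<rceil>"
  have s: "sqrt (real q) \<le> real s" "real s \<le> sqrt (real q) + 1"
    by (simp_all add: s_def)
  have "sqrt (real q) ^ 2 \<le> real s ^ 2" by (intro power_mono s) auto
  then have "q \<le> s\<^sup>2" by (simp flip: of_nat_power)
  have dq: "4 \<le> \<delta> * real q" using q(1) assms by (simp add: field_simps)
  have "4 / \<delta> \<le> sqrt (real q)" using q(2) assms by (intro real_le_rsqrt) auto
  then have "4 \<le> \<delta> * sqrt (real q)" using assms by (simp add: field_simps)
  then have "4 * sqrt (real q) \<le> \<delta> * sqrt (real q) * sqrt (real q)" by (rule mult_right_mono) simp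
  then have "4 * sqrt (real q) \<le> \<delta> * real q" by (simp add: mult.assoc)
  then have 1: "real (q + 2 * s) \<le> (1 + \<delta>) * real q"
    using s(2) dq by (simp add: algebra_simps)
  have 2: "real (q + 1) \<le> (1 + \<delta>) * real q" using dq by (simp add: algebra_simps)
  have "1 \<le> \<delta> * real q * real q" using dq q(3) mult_mono[of 1 "\<delta> * real q" 1 "real q"] by simp
  moreover have "real (q\<^sup>2 - 1) = (real q)\<^sup>2 - 1" using q(3) by (simp add: of_nat_diff)
  ultimately have "(1 - \<delta>) * (real q)\<^sup>2 \<le> real (q\<^sup>2 - 1)"
    by (simp add: algebra_simps power2_eq_square)
  with 1 2 \<open>q \<le> s\<^sup>2\<close> show "\<exists>s. q \<le> s\<^sup>2 \<and> real (q + 1) \<le> (1 + \<delta>) * real q \<and>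
    real (q + 2 * s) \<le> (1 + \<delta>) * real q \<and> (1 - \<delta>) * (real q)\<^sup>2 \<le> real (q\<^sup>2 - 1)"
    by blast
qed

text \<open>
  For a degree \<open>d\<close> one chooses \<open>q * r = 2 ^ i * 3 ^ j\<close> just below \<open>d / 2\<close>, leaving room for the
  factor \<open>(1 + \<delta>)\<^sup>2\<close> by which the two sets of the product exceed \<open>q * r\<close>.
\<close>
lemma cover_pair_asymptotic:
  fixes \<epsilon> :: real
  assumes "0 < \<epsilon>" "\<epsilon> < 1"
  shows "\<forall>\<^sub>F d in sequentially. \<exists>m a b. cover_pair m a b \<and> a + b \<le> d \<and> (1 - \<epsilon>) * (real d)\<^sup>2 \<le> 4 * real m"
proof -
  \<comment> \<open>The losses below add up to the factor \<open>(1 - \<delta>) ^ 8\<close>, which Bernoulli's inequality bounds by \<open>1 - 8 * \<delta>\<close>.\<close>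
  define \<delta> where "\<delta> = \<epsilon> / 8"
  have \<delta>: "0 < \<delta>" "\<delta> < 1" using assms by (auto simp: \<delta>_def)
  obtain Q where Q: "\<And>q :: nat. q \<ge> Q \<Longrightarrow> \<exists>s. q \<le> s\<^sup>2 \<and> real (q + 1) \<le> (1 + \<delta>) * real q \<and>
    real (q + 2 * s) \<le> (1 + \<delta>) * real q \<and> (1 - \<delta>) * (real q)\<^sup>2 \<le> real (q\<^sup>2 - 1)"
    using bose_parameters_asymptotic[OF \<delta>(1)] by blast
  \<comment> \<open>Exponents above \<open>Q\<close> are positive and make both prime powers at least \<open>Q\<close>.\<close>
  obtain x0 where x0: "\<And>x. x \<ge> x0 \<Longrightarrow> \<exists>i\<ge>Suc Q. \<exists>j\<ge>Suc Q. 2 ^ i * 3 ^ j \<le> x \<and> x < (1 + \<delta>) * (2 ^ i * 3 ^ j)"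
    using powers_2_3_dense[OF \<delta>(1), of "Suc Q"] by blast
  have "\<forall>\<^sub>F d in sequentially. real d \<ge> x0 * (2 * (1 + \<delta>)\<^sup>2)"
    using filterlim_real_sequentially unfolding filterlim_at_top by blast
  then show ?thesis
  proof eventually_elim
    case (elim d)
    define x where "x = real d / (2 * (1 + \<delta>)\<^sup>2)"
    have "x \<ge> x0" using elim \<delta> by (simp add: x_def field_simps)
    then obtain i j where ij: "i \<ge> Suc Q" "j \<ge> Suc Q" "2 ^ i * 3 ^ j \<le> x" "x < (1 + \<delta>) * (2 ^ i * 3 ^ j)"
      using x0 by blast
    define q r :: nat where "q = 2 ^ i" and "r = 3 ^ j"
    have "i < q" unfolding q_def by (rule less_exp)
    moreover have "j < r" unfolding r_def by (rule power_gt_expt) simp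
    ultimately have qr: "q \<ge> Q" "r \<ge> Q" using ij by linarith+
    obtain s where s: "q \<le> s\<^sup>2" "real (q + 1) \<le> (1 + \<delta>) * real q"
      "real (q + 2 * s) \<le> (1 + \<delta>) * real q" "(1 - \<delta>) * (real q)\<^sup>2 \<le> real (q\<^sup>2 - 1)"
      using Q[OF qr(1)] by blast
    obtain t where t: "r \<le> t\<^sup>2" "real (r + 1) \<le> (1 + \<delta>) * real r"
      "real (r + 2 * t) \<le> (1 + \<delta>) * real r" "(1 - \<delta>) * (real r)\<^sup>2 \<le> real (r\<^sup>2 - 1)"
      using Q[OF qr(2)] by blast
    define y where "y = real q * real r"
    have y: "y \<le> x" "x < (1 + \<delta>) * y" "y \<ge> 0" using ij by (simp_all add: y_def q_def r_def)
    let ?a = "(q + 1) * (r + 1)" and ?b = "(q + 2 * s) * (r + 2 * t)" and ?m = "(q\<^sup>2 - 1) * (r\<^sup>2 - 1)"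
    have "cover_pair ?m ?a ?b"
      unfolding q_def r_def
      by (intro cover_pair_mult cover_pair_2_power cover_pair_3_power)
        (use ij s(1) t(1) in \<open>auto simp: q_def r_def\<close>)
    moreover have "?a + ?b \<le> d"
    proof -
      have "real ?a \<le> ((1 + \<delta>) * real q) * ((1 + \<delta>) * real r)"
        unfolding of_nat_mult by (intro mult_mono s t) (use \<delta> in auto)
      moreover have "real ?b \<le> ((1 + \<delta>) * real q) * ((1 + \<delta>) * real r)"
        unfolding of_nat_mult by (intro mult_mono s t) (use \<delta> in auto)
      ultimately have "real (?a + ?b) \<le> 2 * (1 + \<delta>)\<^sup>2 * y"
        unfolding of_nat_add by (simp only: y_def power2_eq_square) (simp only: algebra_simps)
      also have "\<dots> \<le> 2 * (1 + \<delta>)\<^sup>2 * x" using y by (intro mult_left_mono) auto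
      also have "\<dots> = real d" using \<delta> by (simp add: x_def)
      finally show ?thesis by linarith
    qed
    moreover have "(1 - \<epsilon>) * (real d)\<^sup>2 \<le> 4 * real ?m"
    proof -
      have "((1 - \<delta>) * (real q)\<^sup>2) * ((1 - \<delta>) * (real r)\<^sup>2) \<le> real ?m"
        unfolding of_nat_mult by (intro mult_mono s t) (use \<delta> in auto)
      then have m: "(1 - \<delta>)\<^sup>2 * y\<^sup>2 \<le> real ?m"
        by (simp add: y_def power2_eq_square mult_ac)
      have inv: "(1 - \<delta>) * (1 + \<delta>) \<le> 1" by (simp add: algebra_simps)
      have "(1 - \<delta>) * x \<le> (1 - \<delta>) * ((1 + \<delta>) * y)" using y \<delta> by (intro mult_left_mono) auto
      also have "\<dots> \<le> y" using mult_right_mono[OF inv y(3)] by (simp add: mult.assoc)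
      finally have xy: "(1 - \<delta>) * x \<le> y" .
      have "(1 - \<delta>)\<^sup>2 * real d = (1 - \<delta>)\<^sup>2 * ((1 + \<delta>)\<^sup>2 * (2 * x))"
        using \<delta> by (simp add: x_def)
      also have "\<dots> = ((1 - \<delta>) * (1 + \<delta>))\<^sup>2 * (2 * x)" by (simp add: power_mult_distrib)
      also have "\<dots> \<le> 1 * (2 * x)"
        using inv \<delta> y by (intro mult_right_mono power_le_one) auto
      finally have "(1 - \<delta>) * ((1 - \<delta>)\<^sup>2 * real d) \<le> (1 - \<delta>) * (2 * x)"
        using \<delta> by (intro mult_left_mono) auto
      also have "\<dots> \<le> 2 * y" using xy by simp
      finally have cube: "(1 - \<delta>) ^ 3 * real d \<le> 2 * y" by (simp add: power3_eq_cube power2_eq_square mult_ac)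
      have sq: "(e * (e ^ 3 * u))\<^sup>2 = e ^ 8 * u\<^sup>2" "(e * (2 * v))\<^sup>2 = 4 * (e\<^sup>2 * v\<^sup>2)" for e u v :: real
      proof -
        have "e * (e ^ 3 * u) = e ^ 4 * u" by (simp add: eval_nat_numeral)
        then show "(e * (e ^ 3 * u))\<^sup>2 = e ^ 8 * u\<^sup>2"
          by (simp add: power_mult_distrib flip: power_mult)
        show "(e * (2 * v))\<^sup>2 = 4 * (e\<^sup>2 * v\<^sup>2)" by (simp add: power_mult_distrib)
      qed
      from cube have "((1 - \<delta>) * ((1 - \<delta>) ^ 3 * real d))\<^sup>2 \<le> ((1 - \<delta>) * (2 * y))\<^sup>2"
        using \<delta> by (intro power_mono mult_left_mono) auto
      then have "(1 - \<delta>) ^ 8 * (real d)\<^sup>2 \<le> 4 * ((1 - \<delta>)\<^sup>2 * y\<^sup>2)"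
        unfolding sq .
      moreover have "1 - \<epsilon> \<le> (1 - \<delta>) ^ 8"
        using Bernoulli_inequality[of "- \<delta>" 8] \<delta> by (simp add: \<delta>_def)
      then have "(1 - \<epsilon>) * (real d)\<^sup>2 \<le> (1 - \<delta>) ^ 8 * (real d)\<^sup>2" by (rule mult_right_mono) simp
      ultimately show ?thesis using m by linarith
    qed
    ultimately show ?case by blast
  qed
qed

lemma eventually_DC_bounds:
  fixes \<epsilon> :: real
  assumes "0 < \<epsilon>" "\<epsilon> < 1"
  shows "\<forall>\<^sub>F d in sequentially. (1 - \<epsilon>) / 2 \<le> real (DC d 2) / (real d)\<^sup>2 \<and>
    real (DC d 2) / (real d)\<^sup>2 \<le> (1 + 1 / real d)\<^sup>2 / 2"
proof -
  have "\<forall>\<^sub>F d in sequentially. real d \<ge> max 2 (4 / (1 - \<epsilon>))"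
    using filterlim_real_sequentially unfolding filterlim_at_top by blast
  with cover_pair_asymptotic[OF assms] show ?thesis
  proof eventually_elim
    case (elim d)
    then obtain m a b where *: "cover_pair m a b" "a + b \<le> d" "(1 - \<epsilon>) * (real d)\<^sup>2 \<le> 4 * real m"
      by blast
    have d: "real d \<ge> 2" "real d \<ge> 4 / (1 - \<epsilon>)" using elim(2) by auto
    then have "4 \<le> (1 - \<epsilon>) * real d" using assms by (simp add: field_simps)
    then have "4 * real d \<le> (1 - \<epsilon>) * real d * real d" by (intro mult_right_mono) auto
    then have "d \<le> m" using *(3) by (simp add: power2_eq_square)
    moreover have "m \<ge> 2" using d(1) \<open>d \<le> m\<close> by linarith
    ultimately obtain S where "dihedral_witness d m S"
      using dihedral_witness_exists[OF *(1,2)] by blast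
    note bounds = DC_bounds[OF this]
    have "(real d)\<^sup>2 > 0" using d(1) by simp
    moreover have "(1 - \<epsilon>) * (real d)\<^sup>2 \<le> 2 * real (DC d 2)"
      using *(3) bounds(1) by linarith
    ultimately have lower: "(1 - \<epsilon>) / 2 \<le> real (DC d 2) / (real d)\<^sup>2"
      by (simp add: le_divide_eq)
    have "real (2 * DC d 2) \<le> real ((d + 1)\<^sup>2)" using bounds(2) by (rule of_nat_mono)
    then have "real (DC d 2) \<le> (real d + 1)\<^sup>2 / 2" by (simp add: add.commute)
    then have "real (DC d 2) / (real d)\<^sup>2 \<le> (real d + 1)\<^sup>2 / 2 / (real d)\<^sup>2"
      by (rule divide_right_mono) simp
    also have "\<dots> = ((real d + 1) / real d)\<^sup>2 / 2" by (simp add: power_divide)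
    also have "(real d + 1) / real d = 1 + 1 / real d" using d(1) by (simp add: add_divide_distrib)
    finally show ?case using lower by blast
  qed
qed

theorem corollary5:
  shows "(\<lambda>d::nat. real (DC d 2) / (real d)\<^sup>2) \<longlonglongrightarrow> 1 / 2"
proof (rule order_tendstoI)
  fix c :: real assume "c < 1 / 2"
  define \<epsilon> where "\<epsilon> = min (1 / 2) (1 / 2 - c)"
  have \<epsilon>: "0 < \<epsilon>" "\<epsilon> < 1" and "\<epsilon> \<le> 1 / 2 - c" using \<open>c < 1 / 2\<close> by (auto simp: \<epsilon>_def)
  with \<open>c < 1 / 2\<close> have c: "c < (1 - \<epsilon>) / 2" by (simp add: field_simps)
  from eventually_DC_bounds[OF \<epsilon>] show "\<forall>\<^sub>F d in sequentially. c < real (DC d 2) / (real d)\<^sup>2"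
    by eventually_elim (use c in linarith)
next
  fix c :: real assume c: "1 / 2 < c"
  have "(\<lambda>d. (1 + 1 / real d)\<^sup>2 / 2) \<longlonglongrightarrow> (1 + 0)\<^sup>2 / 2"
    by (intro tendsto_intros lim_1_over_n) auto
  then have "\<forall>\<^sub>F d in sequentially. (1 + 1 / real d)\<^sup>2 / 2 < c"
    by (rule order_tendstoD) (use c in simp)
  moreover have "\<forall>\<^sub>F d in sequentially. (1 - 1 / 2) / 2 \<le> real (DC d 2) / (real d)\<^sup>2 \<and>
      real (DC d 2) / (real d)\<^sup>2 \<le> (1 + 1 / real d)\<^sup>2 / 2"
    by (rule eventually_DC_bounds) auto
  ultimately show "\<forall>\<^sub>F d in sequentially. real (DC d 2) / (real d)\<^sup>2 < c"
    by eventually_elim linarith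
qed

end
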